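(* Let $K$ be an algebraically closed field and let $P\subseteq\mathrm{GL}_n(K)$ be an upper-block parabolic subgroup with Levi subgroup $L_P$. Let $\mathcal{N}_{\mathfrak{p}}$ be the variety of nilpotent matrices in $\mathfrak{p}=\mathrm{Lie}(P)$. Then $L_P$ acts by conjugation with finitely many orbits on $\mathcal{N}_{\mathfrak{p}}$ if and only if $P=\mathrm{GL}_n(K)$ or $P$ is of block sizes $(1,n-1)$ or $(n-1,1)$.
   Context: The upper-block parabolic subgroup of block sizes $(b_1,\dots,b_p)$ (with $b_i\ge 1$, $b_1+\dots+b_p=n$) is the group of invertible block upper triangular matrices with diagonal blocks of these sizes; its Levi subgroup $L_P\cong\prod_i\mathrm{GL}_{b_i}(K)$ is the subgroup of block diagonal matrices in $P$. *)

theory Defs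
  imports "Jordan_Normal_Form.Determinant" "HOL-Algebra.Group_Action"
begin

definition GL :: "nat \<Rightarrow> 'a::field mat monoid" where
  "GL n = units_of (ring_mat TYPE('a) n ())"

text \<open>Rows and columns are numbered from \<open>0\<close>. For positive block sizes \<open>b = [b\<^sub>1, \<dots>, b\<^sub>p]\<close>
  and \<open>i < sum_list b\<close>, the number (also counted from \<open>0\<close>) of the block containing \<open>i\<close> is\<close>

definition block_index :: "nat list \<Rightarrow> nat \<Rightarrow> nat" where
  "block_index b i = (LEAST k. i < sum_list (take (Suc k) b))"

definition block_upper_triangular :: "nat list \<Rightarrow> 'a::zero mat \<Rightarrow> bool" where
  "block_upper_triangular b A \<longleftrightarrow>
     (\<forall>i<sum_list b. \<forall>j<sum_list b. block_index b j < block_index b i \<longrightarrow> A $$ (i, j) = 0)"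

definition block_diagonal :: "nat list \<Rightarrow> 'a::zero mat \<Rightarrow> bool" where
  "block_diagonal b A \<longleftrightarrow>
     (\<forall>i<sum_list b. \<forall>j<sum_list b. block_index b j \<noteq> block_index b i \<longrightarrow> A $$ (i, j) = 0)"

definition parabolic :: "nat list \<Rightarrow> 'a::field mat set" where
  "parabolic b = {g \<in> carrier (GL (sum_list b)). block_upper_triangular b g}"

definition levi :: "nat list \<Rightarrow> 'a::field mat set" where
  "levi b = {g \<in> parabolic b. block_diagonal b g}"

text \<open>Polynomial functions on \<open>n \<times> n\<close> matrices.\<close>

inductive_set poly_funs :: "nat \<Rightarrow> ('a::field mat \<Rightarrow> 'a) set" for n where
  const: "(\<lambda>A. c) \<in> poly_funs n"
| entry: "i < n \<Longrightarrow> j < n \<Longrightarrow> (\<lambda>A. A $$ (i, j)) \<in> poly_funs n"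
| add: "f \<in> poly_funs n \<Longrightarrow> h \<in> poly_funs n \<Longrightarrow> (\<lambda>A. f A + h A) \<in> poly_funs n"
| mult: "f \<in> poly_funs n \<Longrightarrow> h \<in> poly_funs n \<Longrightarrow> (\<lambda>A. f A * h A) \<in> poly_funs n"

text \<open>The Lie algebra of a closed subgroup \<open>G\<close> of \<open>GL n\<close>, as the Zariski tangent space of \<open>G\<close> at
  the identity: \<open>X\<close> belongs to it iff the differential at \<open>1\<close> of every polynomial \<open>f\<close> vanishing
  on \<open>G\<close> kills \<open>X\<close>. This differential, evaluated at \<open>X\<close>, is the formal derivative at \<open>t = 0\<close> of
  the polynomial \<open>q(t) = f (1 + t X)\<close>, which is determined by its values because the field is
  infinite. Over a finite field the definition is not meaningful.\<close>

definition lie_algebra :: "nat \<Rightarrow> 'a::alg_closed_field mat set \<Rightarrow> 'a mat set" where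
  "lie_algebra n G = {X \<in> carrier_mat n n. \<forall>f\<in>poly_funs n. (\<forall>g\<in>G. f g = 0) \<longrightarrow>
     (\<exists>q. (\<forall>t. poly q t = f (1\<^sub>m n + t \<cdot>\<^sub>m X)) \<and> poly (pderiv q) 0 = 0)}"

definition nilpotent_mat :: "'a::semiring_1 mat \<Rightarrow> bool" where
  "nilpotent_mat A \<longleftrightarrow> (\<exists>k. A ^\<^sub>m k = 0\<^sub>m (dim_row A) (dim_row A))"

definition nilpotent_cone :: "'a::semiring_1 mat set \<Rightarrow> 'a mat set" where
  "nilpotent_cone \<pp> = {X \<in> \<pp>. nilpotent_mat X}"

definition conjugation :: "nat \<Rightarrow> 'a::field mat set \<Rightarrow> 'a mat \<Rightarrow> 'a mat \<Rightarrow> 'a mat" where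
  "conjugation n E g = (\<lambda>X\<in>E. g * X * inv\<^bsub>GL n\<^esub> g)"

subsection \<open>The Lie algebra of a parabolic subgroup\<close>

lemma infinite_alg_closed: "infinite (UNIV :: 'a::alg_closed_field set)"
proof
  assume fin: "finite (UNIV :: 'a set)"
  define p where "p = (\<Prod>a\<in>(UNIV::'a set). [:- a, 1:])"
  have deg: "degree p = card (UNIV :: 'a set)"
    unfolding p_def by (subst degree_prod_eq_sum_degree) auto
  have "card (UNIV :: 'a set) > 0" using fin by (simp add: card_gt_0_iff)
  hence "degree (p + 1) > 0" using deg by (simp add: degree_add_eq_left)
  then obtain x where x: "poly (p + 1) x = 0" using alg_closed_imp_poly_has_root by blast
  have "poly p x = 0" unfolding p_def poly_prod using fin by (auto simp: prod_zero_iff)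
  with x show False by simp
qed

lemma poly_eqI_alg_closed:
  fixes p q :: "'a::alg_closed_field poly"
  assumes "\<And>t. poly p t = poly q t"
  shows "p = q"
proof (rule ccontr)
  assume "p \<noteq> q"
  hence "finite {t. poly (p - q) t = 0}" by (intro poly_roots_finite) auto
  moreover have "{t. poly (p - q) t = 0} = UNIV" using assms by auto
  ultimately show False using infinite_alg_closed by metis
qed

lemma carrier_GL: "carrier (GL n) = {g :: 'a::field mat. g \<in> carrier_mat n n \<and> det g \<noteq> 0}"
proof -
  let ?R = "ring_mat TYPE('a) n ()"
  have "g \<in> Units ?R \<longleftrightarrow> g \<in> carrier_mat n n \<and> det g \<noteq> 0" for g
    using det_non_zero_imp_unit[of g n "()"] unit_imp_det_non_zero[of g n "()"]
    by (auto simp: Units_def ring_mat_simps)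
  thus ?thesis by (auto simp: GL_def units_of_carrier)
qed

lemma poly_funs_line:
  assumes "f \<in> poly_funs n" "X \<in> carrier_mat n n"
  shows "\<exists>q. \<forall>t. poly q t = f (1\<^sub>m n + t \<cdot>\<^sub>m X)"
  using assms
proof induction
  case (const c)
  show ?case by (rule exI[of _ "[:c:]"]) auto
next
  case (entry i j)
  thus ?case by (intro exI[of _ "[:1\<^sub>m n $$ (i,j), X $$ (i,j):]"]) auto
next
  case (add f h)
  thus ?case by (metis poly_add)
next
  case (mult f h)
  thus ?case by (metis poly_mult)
qed

lemma lie_algebra_parabolic:
  "lie_algebra (sum_list b) (parabolic b) =
     {X \<in> carrier_mat (sum_list b) (sum_list b). block_upper_triangular b X}"
  (is "?L = ?R")
proof (intro equalityI subsetI)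
  let ?n = "sum_list b"
  fix X :: "'a mat" assume X: "X \<in> ?L"
  hence Xc: "X \<in> carrier_mat ?n ?n" by (simp add: lie_algebra_def)
  have "X $$ (i, j) = 0" if ij: "i < ?n" "j < ?n" "block_index b j < block_index b i" for i j
  proof -
    have "\<forall>g\<in>parabolic b. (\<lambda>A::'a mat. A $$ (i, j)) g = 0"
      using ij by (auto simp: parabolic_def block_upper_triangular_def)
    moreover have "(\<lambda>A::'a mat. A $$ (i, j)) \<in> poly_funs ?n"
      using ij(1,2) by (rule poly_funs.entry)
    moreover have "\<forall>f\<in>poly_funs ?n. (\<forall>g\<in>parabolic b. f g = 0) \<longrightarrow>
        (\<exists>q. (\<forall>t. poly q t = f (1\<^sub>m ?n + t \<cdot>\<^sub>m X)) \<and> poly (pderiv q) 0 = 0)"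
      using X by (simp add: lie_algebra_def)
    ultimately have "\<exists>q. (\<forall>t. poly q t = (1\<^sub>m ?n + t \<cdot>\<^sub>m X) $$ (i, j)) \<and> poly (pderiv q) 0 = 0"
      by fast
    then obtain q where
      q: "\<And>t. poly q t = (1\<^sub>m ?n + t \<cdot>\<^sub>m X) $$ (i, j)" "poly (pderiv q) 0 = 0"
      by blast
    have "i \<noteq> j" using ij by auto
    hence "q = [:0, X $$ (i, j):]" using q(1) ij Xc by (intro poly_eqI_alg_closed) auto
    thus ?thesis using q(2) by (simp add: pderiv_pCons)
  qed
  with Xc show "X \<in> ?R" by (auto simp: block_upper_triangular_def)
next
  let ?n = "sum_list b"
  fix X :: "'a mat" assume "X \<in> ?R"
  hence Xc: "X \<in> carrier_mat ?n ?n" and up: "block_upper_triangular b X" by auto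
  define M where "M = mat ?n ?n (\<lambda>ij. [:1\<^sub>m ?n $$ ij, X $$ ij:])"
  have D: "poly (det M) t = det (1\<^sub>m ?n + t \<cdot>\<^sub>m X)" for t
  proof -
    interpret comm_ring_hom "\<lambda>p. poly p t" by unfold_locales auto
    have "map_mat (\<lambda>p. poly p t) M = 1\<^sub>m ?n + t \<cdot>\<^sub>m X"
      using Xc by (intro eq_matI) (auto simp: M_def)
    thus ?thesis using hom_det[of M] by simp
  qed
  have "1\<^sub>m ?n + 0 \<cdot>\<^sub>m X = 1\<^sub>m ?n" using Xc by auto
  hence "poly (det M) 0 = 1" using D[of 0] by simp
  hence D0: "det M \<noteq> 0" by auto
  have P: "1\<^sub>m ?n + t \<cdot>\<^sub>m X \<in> parabolic b" if "poly (det M) t \<noteq> 0" for t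
    using that up Xc unfolding D parabolic_def carrier_GL block_upper_triangular_def by auto
  have "\<exists>q. (\<forall>t. poly q t = f (1\<^sub>m ?n + t \<cdot>\<^sub>m X)) \<and> poly (pderiv q) 0 = 0"
    if f: "f \<in> poly_funs ?n" "\<forall>g\<in>parabolic b. f g = 0" for f
  proof -
    obtain q where q: "\<And>t. poly q t = f (1\<^sub>m ?n + t \<cdot>\<^sub>m X)"
      using poly_funs_line[OF f(1) Xc] by blast
    have "q * det M = 0"
      by (rule poly_eqI_alg_closed) (use P f(2) in \<open>auto simp: q\<close>)
    hence "q = 0" using D0 by simp
    thus ?thesis using q by (intro exI[of _ q]) auto
  qed
  thus "X \<in> ?L" using Xc by (auto simp: lie_algebra_def)
qed

subsection \<open>The Levi subgroup acts by conjugation\<close>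

lemma group_GL: "group (GL n :: 'a::field mat monoid)"
proof -
  interpret ring "ring_mat TYPE('a) n ()" by (rule ring_mat)
  show ?thesis unfolding GL_def by (rule units_group)
qed

lemma GL_simps:
  "x \<otimes>\<^bsub>GL n\<^esub> y = x * y" "\<one>\<^bsub>GL n\<^esub> = 1\<^sub>m n"
  by (simp_all add: GL_def units_of_def ring_mat_simps)

lemma GL_inv:
  assumes "g \<in> carrier (GL n)"
  shows "inv\<^bsub>GL n\<^esub> g \<in> carrier (GL n)" "inv\<^bsub>GL n\<^esub> g \<in> carrier_mat n n"
    "g * inv\<^bsub>GL n\<^esub> g = 1\<^sub>m n" "inv\<^bsub>GL n\<^esub> g * g = 1\<^sub>m n"
proof -
  interpret group "GL n" by (rule group_GL)
  show "inv\<^bsub>GL n\<^esub> g \<in> carrier (GL n)" using assms by simp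
  thus "inv\<^bsub>GL n\<^esub> g \<in> carrier_mat n n" by (simp add: carrier_GL)
  show "g * inv\<^bsub>GL n\<^esub> g = 1\<^sub>m n" "inv\<^bsub>GL n\<^esub> g * g = 1\<^sub>m n"
    using assms r_inv l_inv by (auto simp: GL_simps)
qed

lemma block_upper_triangular_mult:
  fixes A B :: "'a::semiring_1 mat"
  assumes "A \<in> carrier_mat (sum_list b) (sum_list b)" "B \<in> carrier_mat (sum_list b) (sum_list b)"
    "block_upper_triangular b A" "block_upper_triangular b B"
  shows "block_upper_triangular b (A * B)"
  unfolding block_upper_triangular_def
proof (intro allI impI)
  fix i j assume ij: "i < sum_list b" "j < sum_list b" "block_index b j < block_index b i"
  have "A $$ (i, k) * B $$ (k, j) = 0" if k: "k < sum_list b" for k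
  proof (cases "block_index b k < block_index b i")
    case True thus ?thesis using assms(3) ij k by (auto simp: block_upper_triangular_def)
  next
    case False
    hence "block_index b j < block_index b k" using ij by auto
    thus ?thesis using assms(4) ij k by (auto simp: block_upper_triangular_def)
  qed
  thus "(A * B) $$ (i, j) = 0"
    using assms(1,2) ij by (auto simp: scalar_prod_def intro!: sum.neutral)
qed

definition block_proj :: "nat list \<Rightarrow> nat \<Rightarrow> 'a::semiring_1 mat" where
  "block_proj b k = mat (sum_list b) (sum_list b)
     (\<lambda>(i, j). if i = j \<and> block_index b i = k then 1 else 0)"

lemma block_diagonal_iff_commute:
  fixes A :: "'a::semiring_1 mat"
  assumes A: "A \<in> carrier_mat (sum_list b) (sum_list b)"
  shows "block_diagonal b A \<longleftrightarrow> (\<forall>k. block_proj b k * A = A * block_proj b k)"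
proof -
  let ?n = "sum_list b"
  have l: "(block_proj b k * A) $$ (i, j) = (if block_index b i = k then A $$ (i, j) else 0)"
    if "i < ?n" "j < ?n" for i j k
  proof -
    have "(block_proj b k * A) $$ (i, j) =
        (\<Sum>l\<in>{0..<?n}. (if i = l \<and> block_index b i = k then 1 else 0) * A $$ (l, j))"
      using A that unfolding block_proj_def by (simp add: scalar_prod_def)
    also have "\<dots> =
        (\<Sum>l\<in>{0..<?n}. if l = i then (if block_index b i = k then A $$ (i, j) else 0) else 0)"
      by (intro sum.cong) auto
    finally have "(block_proj b k * A) $$ (i, j) = \<dots>" .
    thus ?thesis using that by (simp add: sum.delta)
  qed
  have r: "(A * block_proj b k) $$ (i, j) = (if block_index b j = k then A $$ (i, j) else 0)"
    if "i < ?n" "j < ?n" for i j k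
  proof -
    have "(A * block_proj b k) $$ (i, j) =
        (\<Sum>l\<in>{0..<?n}. A $$ (i, l) * (if l = j \<and> block_index b l = k then 1 else 0))"
      using A that unfolding block_proj_def by (simp add: scalar_prod_def)
    also have "\<dots> =
        (\<Sum>l\<in>{0..<?n}. if l = j then (if block_index b j = k then A $$ (i, j) else 0) else 0)"
      by (intro sum.cong) auto
    finally have "(A * block_proj b k) $$ (i, j) = \<dots>" .
    thus ?thesis using that by (simp add: sum.delta)
  qed
  show ?thesis
  proof
    assume d: "block_diagonal b A"
    show "\<forall>k. block_proj b k * A = A * block_proj b k"
    proof
      fix k
      have dims: "block_proj b k * A \<in> carrier_mat ?n ?n" "A * block_proj b k \<in> carrier_mat ?n ?n"
        using A by (auto simp: block_proj_def)
      show "block_proj b k * A = A * block_proj b k"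
      proof (rule eq_matI)
        fix i j
        assume "i < dim_row (A * block_proj b k)" "j < dim_col (A * block_proj b k)"
        hence ij: "i < ?n" "j < ?n" using dims by auto
        show "(block_proj b k * A) $$ (i, j) = (A * block_proj b k) $$ (i, j)"
          unfolding l[OF ij] r[OF ij] using d ij by (auto simp: block_diagonal_def)
      qed (use dims A in \<open>auto simp: block_proj_def\<close>)
    qed
  next
    assume c: "\<forall>k. block_proj b k * A = A * block_proj b k"
    show "block_diagonal b A"
      unfolding block_diagonal_def
    proof (intro allI impI)
      fix i j assume ij: "i < ?n" "j < ?n" and ne: "block_index b j \<noteq> block_index b i"
      from c l[OF ij, of "block_index b i"] r[OF ij, of "block_index b i"] ne
      show "A $$ (i, j) = 0" by auto
    qed
  qed
qed

lemma block_diagonal_imp_upper: "block_diagonal b A \<Longrightarrow> block_upper_triangular b A"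
  by (auto simp: block_diagonal_def block_upper_triangular_def)

lemma levi_alt: "levi b = {g \<in> carrier (GL (sum_list b)). block_diagonal b g}"
  by (auto simp: levi_def parabolic_def block_diagonal_imp_upper)

lemma subgroup_levi: "subgroup (levi b) (GL (sum_list b))"
proof -
  let ?n = "sum_list b"
  interpret group "GL ?n :: 'a mat monoid" by (rule group_GL)
  have pc: "(block_proj b k :: 'a mat) \<in> carrier_mat ?n ?n" for k by (simp add: block_proj_def)
  have lc: "g \<in> carrier_mat ?n ?n" if "g \<in> levi b" for g :: "'a mat"
    using that by (simp add: levi_alt carrier_GL)
  have com: "block_proj b k * g = g * block_proj b k" if "g \<in> levi b" for g :: "'a mat" and k
    using that lc[OF that] by (auto simp: levi_alt block_diagonal_iff_commute)
  show ?thesis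
  proof
    show "levi b \<subseteq> carrier (GL ?n)" by (auto simp: levi_alt)
    show "\<one>\<^bsub>GL ?n\<^esub> \<in> levi b"
      by (auto simp: levi_alt GL_simps carrier_GL block_diagonal_def)
    fix x :: "'a mat" assume x: "x \<in> levi b"
    hence xG: "x \<in> carrier (GL ?n)" by (simp add: levi_alt)
    note xi = GL_inv[OF xG]
    have "block_proj b k * inv\<^bsub>GL ?n\<^esub> x = inv\<^bsub>GL ?n\<^esub> x * block_proj b k" for k
    proof -
      let ?y = "inv\<^bsub>GL ?n\<^esub> x" and ?e = "block_proj b k :: 'a mat"
      have "?e * ?y = (?y * x) * (?e * ?y)"
        unfolding xi(4) using left_mult_one_mat[OF mult_carrier_mat[OF pc[of k] xi(2)]] by simp
      also have "\<dots> = ?y * (x * ?e) * ?y"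
        using xi(2) pc[of k] lc[OF x] by (simp add: assoc_mult_mat[of _ ?n ?n _ ?n _ ?n]
          mult_carrier_mat[of _ ?n ?n _ ?n])
      also have "x * ?e = ?e * x" using com[OF x] by simp
      also have "?y * (?e * x) * ?y = ?y * ?e * (x * ?y)"
        using xi(2) pc[of k] lc[OF x] by (simp add: assoc_mult_mat[of _ ?n ?n _ ?n _ ?n]
          mult_carrier_mat[of _ ?n ?n _ ?n])
      also have "\<dots> = ?y * ?e"
        unfolding xi(3) using right_mult_one_mat[OF mult_carrier_mat[OF xi(2) pc[of k]]] by simp
      finally show ?thesis .
    qed
    thus "inv\<^bsub>GL ?n\<^esub> x \<in> levi b"
      using xi by (auto simp: levi_alt block_diagonal_iff_commute)
    fix y :: "'a mat" assume y: "y \<in> levi b"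
    have "block_proj b k * (x * y) = (x * y) * block_proj b k" for k
    proof -
      let ?e = "block_proj b k :: 'a mat"
      note c = lc[OF x] lc[OF y] pc[of k]
      have "?e * (x * y) = (?e * x) * y" using c by (simp add: assoc_mult_mat[of _ ?n ?n _ ?n _ ?n]
          mult_carrier_mat[of _ ?n ?n _ ?n])
      also have "\<dots> = x * (?e * y)" using c unfolding com[OF x] by (simp add: assoc_mult_mat[of _ ?n ?n _ ?n _ ?n]
          mult_carrier_mat[of _ ?n ?n _ ?n])
      also have "\<dots> = (x * y) * ?e" using c unfolding com[OF y] by (simp add: assoc_mult_mat[of _ ?n ?n _ ?n _ ?n]
          mult_carrier_mat[of _ ?n ?n _ ?n])
      finally show ?thesis .
    qed
    moreover have "x * y \<in> carrier (GL ?n)"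
      using m_closed[of x y] x y by (simp add: levi_alt GL_simps)
    ultimately show "x \<otimes>\<^bsub>GL ?n\<^esub> y \<in> levi b"
      using lc[OF x] lc[OF y] by (auto simp: levi_alt GL_simps block_diagonal_iff_commute)
  qed
qed

lemma nilpotent_mat_conj:
  fixes X :: "'a::field mat"
  assumes "g \<in> carrier (GL n)" "X \<in> carrier_mat n n" "nilpotent_mat X"
  shows "nilpotent_mat (g * X * inv\<^bsub>GL n\<^esub> g)"
proof -
  note gi = GL_inv[OF assms(1)]
  have gc: "g \<in> carrier_mat n n" using assms(1) by (simp add: carrier_GL)
  let ?Y = "g * X * inv\<^bsub>GL n\<^esub> g"
  have sw: "similar_mat_wit ?Y X g (inv\<^bsub>GL n\<^esub> g)"
    using gi gc assms(2) by (auto simp: similar_mat_wit_def Let_def)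
  obtain k where k: "X ^\<^sub>m k = 0\<^sub>m n n"
    using assms(2,3) by (auto simp: nilpotent_mat_def)
  have "?Y ^\<^sub>m k = g * (X ^\<^sub>m k) * inv\<^bsub>GL n\<^esub> g"
    using similar_mat_wit_pow[OF sw, of k] by (simp add: similar_mat_wit_def Let_def)
  also have "\<dots> = 0\<^sub>m n n" using k gc gi by simp
  finally show ?thesis using gc by (auto simp: nilpotent_mat_def)
qed

lemma levi_action:
  "group_action ((GL (sum_list b))\<lparr>carrier := levi b\<rparr>)
     (nilpotent_cone (lie_algebra (sum_list b) (parabolic b)))
     (conjugation (sum_list b) (nilpotent_cone (lie_algebra (sum_list b) (parabolic b))))"
  (is "group_action ?L ?E ?\<phi>")
proof -
  let ?n = "sum_list b"
  interpret GLn: group "GL ?n :: 'a mat monoid" by (rule group_GL)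
  interpret sub: subgroup "levi b" "GL ?n :: 'a mat monoid" by (rule subgroup_levi)
  have E: "?E = {X \<in> carrier_mat ?n ?n. block_upper_triangular b X \<and> nilpotent_mat X}"
    unfolding nilpotent_cone_def lie_algebra_parabolic by auto
  have lG: "g \<in> carrier (GL ?n)" and lc: "g \<in> carrier_mat ?n ?n"
    and lu: "block_upper_triangular b g" if "g \<in> levi b" for g :: "'a mat"
    using that by (auto simp: levi_alt carrier_GL block_diagonal_imp_upper)
  have cl: "g * X * inv\<^bsub>GL ?n\<^esub> g \<in> ?E" if g: "g \<in> levi b" and X: "X \<in> ?E" for g X
  proof -
    have Xc: "X \<in> carrier_mat ?n ?n" "block_upper_triangular b X" "nilpotent_mat X"
      using X unfolding E by auto
    have iL: "inv\<^bsub>GL ?n\<^esub> g \<in> levi b" using g by simp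
    have "block_upper_triangular b (g * X * inv\<^bsub>GL ?n\<^esub> g)"
      using Xc lc[OF g] lu[OF g] lc[OF iL] lu[OF iL]
      by (intro block_upper_triangular_mult) auto
    thus ?thesis using nilpotent_mat_conj[OF lG[OF g] Xc(1,3)] lc[OF g] lc[OF iL] Xc
      unfolding E by auto
  qed
  have comp: "g * (h * X * inv\<^bsub>GL ?n\<^esub> h) * inv\<^bsub>GL ?n\<^esub> g =
      (g * h) * X * inv\<^bsub>GL ?n\<^esub> (g * h)"
    if "g \<in> levi b" "h \<in> levi b" "X \<in> ?E" for g h X
  proof -
    have "inv\<^bsub>GL ?n\<^esub> (g * h) = inv\<^bsub>GL ?n\<^esub> h * inv\<^bsub>GL ?n\<^esub> g"
      using GLn.inv_mult_group[of g h] that by (simp add: lG GL_simps)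
    moreover have "X \<in> carrier_mat ?n ?n" using that unfolding E by auto
    ultimately show ?thesis
      using lc[OF that(1)] lc[OF that(2)] GL_inv(2)[OF lG[OF that(1)]] GL_inv(2)[OF lG[OF that(2)]]
      by (simp add: assoc_mult_mat[of _ ?n ?n _ ?n _ ?n]
          mult_carrier_mat[of _ ?n ?n _ ?n])
  qed
  have inv1: "inv\<^bsub>GL ?n\<^esub> (1\<^sub>m ?n :: 'a mat) = 1\<^sub>m ?n"
    using GLn.inv_one by (simp add: GL_simps)
  have one: "1\<^sub>m ?n * X * inv\<^bsub>GL ?n\<^esub> (1\<^sub>m ?n) = X" if "X \<in> ?E" for X
    using that unfolding E inv1 by auto
  have bij: "bij_betw (?\<phi> g) ?E ?E" if g: "g \<in> levi b" for g
  proof (rule bij_betw_byWitness[where f' = "?\<phi> (inv\<^bsub>GL ?n\<^esub> g)"])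
    have gi: "inv\<^bsub>GL ?n\<^esub> g \<in> levi b" using g by simp
    show "\<forall>X\<in>?E. ?\<phi> (inv\<^bsub>GL ?n\<^esub> g) (?\<phi> g X) = X"
      using cl[OF g] comp[OF gi g] GL_inv(4)[OF lG[OF g]] one
      by (simp add: conjugation_def)
    show "\<forall>X\<in>?E. ?\<phi> g (?\<phi> (inv\<^bsub>GL ?n\<^esub> g) X) = X"
      using cl[OF gi] comp[OF g gi] GL_inv(3)[OF lG[OF g]] one
      by (simp add: conjugation_def)
    show "?\<phi> g ` ?E \<subseteq> ?E" using cl[OF g] by (auto simp: conjugation_def)
    show "?\<phi> (inv\<^bsub>GL ?n\<^esub> g) ` ?E \<subseteq> ?E" using cl[OF gi] by (auto simp: conjugation_def)
  qed
  have Bij: "?\<phi> g \<in> Bij ?E" if "g \<in> levi b" for g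
    using bij[OF that] by (auto simp: Bij_def conjugation_def)
  have "?\<phi> \<in> hom ?L (BijGroup ?E)"
  proof (rule homI)
    fix g assume "g \<in> carrier ?L"
    thus "?\<phi> g \<in> carrier (BijGroup ?E)" using Bij by (simp add: BijGroup_def)
  next
    fix g h assume "g \<in> carrier ?L" "h \<in> carrier ?L"
    hence gh: "g \<in> levi b" "h \<in> levi b" by auto
    have "?\<phi> (g * h) = compose ?E (?\<phi> g) (?\<phi> h)"
      using comp[OF gh] cl[OF gh(2)] by (auto simp: conjugation_def compose_def)
    thus "?\<phi> (g \<otimes>\<^bsub>?L\<^esub> h) = ?\<phi> g \<otimes>\<^bsub>BijGroup ?E\<^esub> ?\<phi> h"
      using Bij gh by (simp add: BijGroup_def GL_simps)
  qed
  moreover have "group ?L" by (rule sub.subgroup_is_group[OF group_GL])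
  ultimately show ?thesis
    by (simp add: group_action_def group_hom_def group_hom_axioms_def group_BijGroup)
qed

end

theory Submission
  imports Defs "Jordan_Normal_Form.Jordan_Normal_Form_Existence"
begin

text \<open>
  The set \<open>N\<close> consists of the nilpotent block upper triangular matrices, and two of them lie in the
  same orbit iff an invertible block diagonal matrix conjugates one into the other.

  Finiteness is obtained by bringing every element of \<open>N\<close> to a form with all entries in \<open>{0, 1}\<close>.
  With a single block this is the Jordan normal form. With block sizes \<open>(n - 1, 1)\<close> an element of
  \<open>N\<close> amounts to a nilpotent matrix \<open>A\<close> of size \<open>n - 1\<close> and a vector, on which \<open>GL\<close> acts
  simultaneously. Once \<open>A\<close> is in Jordan form, the polynomials in each Jordan block still commute with
  \<open>A\<close>; on every block an invertible one moves the component of the vector to a unit vector or to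
  zero (\<open>jordan_block_0_stabilizer_vec\<close>, \<open>nilpotent_mat_col_normal_form\<close>). Block sizes
  \<open>(1, n - 1)\<close> reduce to the same normal form by transposition.

  In all other cases there are at least three blocks, or two of size at least two. Then there is a
  family \<open>X\<^sub>t\<close> in \<open>N\<close>, supported on three or four indices, whose members are pairwise not conjugate
  under block diagonal matrices (\<open>infinite_orbits_three_blocks\<close>,
  \<open>infinite_orbits_two_large_blocks\<close>). For three blocks \<open>t\<close> relates the corner entry to the product
  of the two entries that form a path to it. For two large blocks, the diagonal blocks are taken to be
  regular nilpotent on a pair of indices each; for \<open>2 \<times> 2\<close> blocks the pairs of matrices commuting
  with them form, up to scalars, a group of dimension three, too small to act with finitely many
  orbits on the four-dimensional space of off-diagonal blocks. The field being infinite, these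
  families give infinitely many orbits.
\<close>

section \<open>Nilpotent matrices over a field\<close>

lemma nilpotent_mat_similar:
  assumes "similar_mat A B" "nilpotent_mat A"
  shows "nilpotent_mat B"
proof -
  obtain P Q where w: "similar_mat_wit A B P Q"
    using assms(1) by (auto simp: similar_mat_def)
  define n where "n = dim_row A"
  note wD = similar_mat_witD[OF n_def w]
  obtain k where k: "A ^\<^sub>m k = 0\<^sub>m n n" using assms(2) by (auto simp: nilpotent_mat_def n_def)
  have "B ^\<^sub>m k = Q * A ^\<^sub>m k * P"
    using similar_mat_wit_pow[OF similar_mat_wit_sym[OF w], of k]
    by (simp add: similar_mat_wit_def Let_def)
  also have "\<dots> = 0\<^sub>m n n" unfolding k using wD by simp
  finally show ?thesis using wD(5) by (auto simp: nilpotent_mat_def)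
qed

lemma nilpotent_mat_eigenvalue:
  fixes A :: "'a::field mat"
  assumes A: "A \<in> carrier_mat n n" and nil: "nilpotent_mat A" and ev: "eigenvalue A e"
  shows "e = 0"
proof -
  obtain v where v: "eigenvector A v e" using ev by (auto simp: eigenvalue_def)
  obtain k where k: "A ^\<^sub>m k = 0\<^sub>m n n" using nil A by (auto simp: nilpotent_mat_def)
  have vc: "v \<in> carrier_vec n" "v \<noteq> 0\<^sub>v n" using v A by (auto simp: eigenvector_def)
  then obtain i where i: "i < n" "v $ i \<noteq> 0" by (metis carrier_vecD eq_vecI index_zero_vec)
  have "e ^ k \<cdot>\<^sub>v v = 0\<^sub>m n n *\<^sub>v v" using eigenvector_pow[OF A v, of k] k by simp
  also have "\<dots> = 0\<^sub>v n" using vc by (intro eq_vecI) auto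
  finally have "(e ^ k \<cdot>\<^sub>v v) $ i = 0" using i by simp
  thus ?thesis using i vc by auto
qed

lemma pow_four_block_upper:
  fixes A B D :: "'a::semiring_1 mat"
  assumes "A \<in> carrier_mat n n" "B \<in> carrier_mat n m" "D \<in> carrier_mat m m"
  shows "\<exists>C\<in>carrier_mat n m. four_block_mat A B (0\<^sub>m m n) D ^\<^sub>m k
           = four_block_mat (A ^\<^sub>m k) C (0\<^sub>m m n) (D ^\<^sub>m k)"
proof (induct k)
  case 0
  show ?case using assms by (intro bexI[of _ "0\<^sub>m n m"]) auto
next
  case (Suc k)
  then obtain C where C: "C \<in> carrier_mat n m"
    "four_block_mat A B (0\<^sub>m m n) D ^\<^sub>m k = four_block_mat (A ^\<^sub>m k) C (0\<^sub>m m n) (D ^\<^sub>m k)" by blast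
  have "four_block_mat A B (0\<^sub>m m n) D ^\<^sub>m Suc k
      = four_block_mat (A ^\<^sub>m k) C (0\<^sub>m m n) (D ^\<^sub>m k) * four_block_mat A B (0\<^sub>m m n) D"
    using C by simp
  also have "\<dots> = four_block_mat (A ^\<^sub>m Suc k) (A ^\<^sub>m k * B + C * D) (0\<^sub>m m n) (D ^\<^sub>m Suc k)"
    using assms C by (subst mult_four_block_mat[of _ n n _ m _ m _ _ n _ m])
      (auto intro!: cong_four_block_mat)
  finally show ?case
    using assms C by (intro bexI[of _ "A ^\<^sub>m k * B + C * D"]) auto
qed

text \<open>The diagonal blocks of a power of a block upper triangular matrix are the powers of its diagonal
  blocks, so the vanishing of a power passes to them.\<close>

lemma nilpotent_four_block_upperD:
  fixes A B D :: "'a::semiring_1 mat"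
  assumes c: "A \<in> carrier_mat n n" "B \<in> carrier_mat n m" "D \<in> carrier_mat m m"
    and nil: "nilpotent_mat (four_block_mat A B (0\<^sub>m m n) D)"
  shows "nilpotent_mat A" "nilpotent_mat D"
proof -
  obtain k where k: "four_block_mat A B (0\<^sub>m m n) D ^\<^sub>m k = 0\<^sub>m (n + m) (n + m)"
    using nil c by (auto simp: nilpotent_mat_def)
  obtain C where C: "C \<in> carrier_mat n m"
    "four_block_mat (A ^\<^sub>m k) C (0\<^sub>m m n) (D ^\<^sub>m k) = 0\<^sub>m (n + m) (n + m)"
    using pow_four_block_upper[OF c, of k] k by auto
  have e: "four_block_mat (A ^\<^sub>m k) C (0\<^sub>m m n) (D ^\<^sub>m k) $$ (i, j) = 0"
    if "i < n + m" "j < n + m" for i j using C that by simp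
  have "A ^\<^sub>m k = 0\<^sub>m n n"
  proof (rule eq_matI)
    fix i j assume "i < dim_row (0\<^sub>m n n :: 'a mat)" "j < dim_col (0\<^sub>m n n :: 'a mat)"
    thus "(A ^\<^sub>m k) $$ (i, j) = 0\<^sub>m n n $$ (i, j)"
      using e[of i j] c by (auto split: if_splits)
  qed (use c in auto)
  thus "nilpotent_mat A" using c by (auto simp: nilpotent_mat_def)
  have "D ^\<^sub>m k = 0\<^sub>m m m"
  proof (rule eq_matI)
    fix i j assume "i < dim_row (0\<^sub>m m m :: 'a mat)" "j < dim_col (0\<^sub>m m m :: 'a mat)"
    thus "(D ^\<^sub>m k) $$ (i, j) = 0\<^sub>m m m $$ (i, j)"
      using e[of "n + i" "n + j"] c by (auto split: if_splits)
  qed (use c in auto)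
  thus "nilpotent_mat D" using c by (auto simp: nilpotent_mat_def)
qed

lemma nilpotent_mat_1x1:
  fixes A :: "'a::field mat"
  assumes A: "A \<in> carrier_mat 1 1" and nil: "nilpotent_mat A"
  shows "A = 0\<^sub>m 1 1"
proof -
  have "eigenvalue A (A $$ (0, 0))"
    unfolding eigenvalue_def eigenvector_def
    using A by (intro exI[of _ "vec 1 (\<lambda>_. 1)"]) (auto simp: scalar_prod_def vec_eq_iff)
  hence "A $$ (0, 0) = 0" by (rule nilpotent_mat_eigenvalue[OF A nil])
  thus ?thesis using A by (intro eq_matI) auto
qed

lemma strictly_upper_triangular_nilpotent:
  fixes A :: "'a::semiring_1 mat"
  assumes A: "A \<in> carrier_mat n n"
    and up: "\<And>i j. i < n \<Longrightarrow> j \<le> i \<Longrightarrow> A $$ (i, j) = 0"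
  shows "nilpotent_mat A"
proof -
  have "(A ^\<^sub>m k) $$ (i, j) = 0" if "i < n" "j < n" "j < i + k" for i j k
    using that
  proof (induct k arbitrary: i j)
    case 0
    thus ?case using A by auto
  next
    case (Suc k)
    have "(A ^\<^sub>m k) $$ (i, l) * A $$ (l, j) = 0" if l: "l < n" for l
    proof (cases "l < i + k")
      case True
      thus ?thesis using Suc.hyps[OF Suc.prems(1) l] by simp
    next
      case False
      hence "A $$ (l, j) = 0" using Suc.prems l by (intro up) auto
      thus ?thesis by simp
    qed
    thus ?case using A Suc.prems
      by (auto simp: scalar_prod_def intro!: sum.neutral)
  qed
  hence "A ^\<^sub>m n = 0\<^sub>m n n" using A by (intro eq_matI) auto
  thus ?thesis using A by (auto simp: nilpotent_mat_def)
qed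

text \<open>If \<open>v\<close> has a nonzero entry in row \<open>i\<close>, replace the unit vector \<open>e\<^sub>i\<close> in the standard basis by
  \<open>v\<close> and list \<open>v\<close> first. When \<open>i \<noteq> 0\<close> the slot of column \<open>i\<close> is taken by \<open>e\<^sub>0\<close>, which has been
  displaced by \<open>v\<close>.\<close>

lemma exists_invertible_col_0:
  fixes v :: "'a::field vec"
  assumes v: "v \<in> carrier_vec n" "v \<noteq> 0\<^sub>v n"
  shows "\<exists>P\<in>carrier_mat n n. det P \<noteq> 0 \<and> col P 0 = v"
proof -
  obtain i where i: "i < n" "v $ i \<noteq> 0"
    using v by (metis carrier_vecD eq_vecI index_zero_vec)
  define P where "P = mat n n (\<lambda>(r, c). if c = 0 then v $ r
    else if c = i then (if r = 0 then 1 else 0) else if r = c then 1 else (0::'a))"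
  have P: "P \<in> carrier_mat n n" by (simp add: P_def)
  have "x = 0\<^sub>v n" if x: "x \<in> carrier_vec n" "P *\<^sub>v x = 0\<^sub>v n" for x
  proof -
    have row: "(\<Sum>c<n. P $$ (r, c) * x $ c) = 0" if "r < n" for r
    proof -
      have "(P *\<^sub>v x) $ r = (\<Sum>c<n. P $$ (r, c) * x $ c)"
        using P x(1) that by (simp add: scalar_prod_def atLeast0LessThan)
      thus ?thesis using x(2) that by simp
    qed
    have split: "(\<Sum>c<n. P $$ (r, c) * x $ c) = v $ r * x $ 0 + (if r = 0 \<or> r = i then 0 else x $ r)
       + (if r = 0 \<and> i \<noteq> 0 then x $ i else 0)" if r: "r < n" for r
    proof -
      have "(\<Sum>c<n. P $$ (r, c) * x $ c) = (\<Sum>c<n. (if c = 0 then v $ r * x $ 0 else 0)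
          + (if c = r then (if r = 0 \<or> r = i then 0 else x $ r) else 0)
          + (if c = i then (if r = 0 \<and> i \<noteq> 0 then x $ i else 0) else 0))"
        using r by (intro sum.cong) (auto simp: P_def)
      also have "\<dots> = v $ r * x $ 0 + (if r = 0 \<or> r = i then 0 else x $ r)
          + (if r = 0 \<and> i \<noteq> 0 then x $ i else 0)"
        using r i by (simp add: sum.distrib sum.delta)
      finally show ?thesis .
    qed
    have x0: "x $ 0 = 0"
      using row[OF i(1)] split[OF i(1)] i by (auto split: if_splits)
    have "x $ r = 0" if r: "r < n" for r
    proof (cases "r = i")
      case True
      thus ?thesis using row[of 0] split[of 0] x0 i by (cases "i = 0") auto
    next
      case False
      thus ?thesis using row[OF r] split[OF r] x0 by (cases "r = 0") auto
    qed
    thus ?thesis using x by auto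
  qed
  hence "det P \<noteq> 0" using det_0_iff_vec_prod_zero_field[OF P] by blast
  moreover have "col P 0 = v" using i v by (auto simp: P_def)
  ultimately show ?thesis using P by blast
qed

lemma det_nonzero_inverse:
  fixes P :: "'a::field mat"
  assumes "P \<in> carrier_mat n n" "det P \<noteq> 0"
  obtains Q where "Q \<in> carrier_mat n n" "P * Q = 1\<^sub>m n" "Q * P = 1\<^sub>m n"
proof -
  have "P \<in> carrier (GL n)" using assms by (simp add: carrier_GL)
  from GL_inv[OF this] that show ?thesis by blast
qed

lemma nilpotent_mat_kernel:
  fixes A :: "'a::field mat"
  assumes A: "A \<in> carrier_mat n n" and nil: "nilpotent_mat A" and n: "n > 0"
  obtains v where "v \<in> carrier_vec n" "v \<noteq> 0\<^sub>v n" "A *\<^sub>v v = 0\<^sub>v n"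
proof -
  obtain k where k: "A ^\<^sub>m k = 0\<^sub>m n n" using nil A by (auto simp: nilpotent_mat_def)
  have p: "det (A ^\<^sub>m k) = det A ^ k" for k
    by (induct k) (use A in \<open>auto simp: det_mult[of _ n]\<close>)
  have "det A ^ k = 0" using p[of k] k n by simp
  hence "det A = 0" by simp
  thus ?thesis using that det_0_iff_vec_prod_zero_field[OF A] by blast
qed

text \<open>Over any field a nilpotent matrix has a kernel vector. In a basis that begins with one, the first
  column vanishes, the remaining diagonal block is again nilpotent, and induction applies to it.\<close>

lemma nilpotent_mat_triangularizable:
  fixes A :: "'a::field mat"
  assumes "A \<in> carrier_mat n n" "nilpotent_mat A"
  shows "\<exists>B\<in>carrier_mat n n. similar_mat A B \<and> upper_triangular B"
  using assms
proof (induct n arbitrary: A)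
  case 0
  thus ?case by (intro bexI[of _ A]) (auto intro: similar_mat_refl)
next
  case (Suc n)
  obtain v where v: "v \<in> carrier_vec (Suc n)" "v \<noteq> 0\<^sub>v (Suc n)" "A *\<^sub>v v = 0\<^sub>v (Suc n)"
    using nilpotent_mat_kernel[OF Suc.prems] by auto
  obtain P where P: "P \<in> carrier_mat (Suc n) (Suc n)" "det P \<noteq> 0" "col P 0 = v"
    using exists_invertible_col_0[OF v(1,2)] by auto
  obtain Q where Q: "Q \<in> carrier_mat (Suc n) (Suc n)" "P * Q = 1\<^sub>m (Suc n)" "Q * P = 1\<^sub>m (Suc n)"
    using det_nonzero_inverse[OF P(1,2)] .
  define B where "B = Q * A * P"
  have Bc: "B \<in> carrier_mat (1 + n) (1 + n)" using P Q Suc.prems by (auto simp: B_def)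
  have "similar_mat_wit B A Q P"
    using P Q Suc.prems by (intro similar_mat_witI[of _ _ "Suc n"]) (auto simp: B_def)
  hence sim: "similar_mat A B" using similar_mat_sym unfolding similar_mat_def by blast
  have "col B 0 = (Q * A) *\<^sub>v col P 0"
    unfolding B_def by (rule col_mult2[of _ "Suc n" "Suc n" _ "Suc n"]) (use P Q Suc.prems in auto)
  also have "\<dots> = Q *\<^sub>v (A *\<^sub>v v)"
    unfolding P(3) by (rule assoc_mult_mat_vec) (use P Q Suc.prems v in auto)
  also have "\<dots> = 0\<^sub>v (Suc n)" unfolding v(3) using Q by (intro eq_vecI) auto
  finally have col0: "B $$ (i, 0) = 0" if "i < Suc n" for i
    using that Bc by (metis add_Suc carrier_matD(1) index_col index_zero_vec(1) carrier_matD(2)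
        plus_1_eq_Suc zero_less_Suc)
  obtain B1 B2 B3 B4 where s: "split_block B 1 1 = (B1, B2, B3, B4)" by (cases "split_block B 1 1") auto
  note sb = split_block[OF s, of n n]
  have d: "dim_row B = 1 + n" "dim_col B = 1 + n" using Bc by auto
  note sb = sb[OF d]
  have "B1 = 0\<^sub>m 1 1" "B3 = 0\<^sub>m n 1"
    using s col0 d by (auto simp: split_block_def Let_def)
  note B = sb(5)[unfolded this]
  have "nilpotent_mat B" using nilpotent_mat_similar[OF sim Suc.prems(2)] .
  hence "nilpotent_mat B4"
    using nilpotent_four_block_upperD(2)[of "0\<^sub>m 1 1" 1 B2 n B4] sb B by auto
  then obtain T where T: "T \<in> carrier_mat n n" "similar_mat B4 T" "upper_triangular T"
    using Suc.hyps[OF sb(4)] by blast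
  have "similar_mat (0\<^sub>m 1 1 :: 'a mat) (0\<^sub>m 1 1)" by (rule similar_mat_refl) auto
  then obtain C where C: "C \<in> carrier_mat 1 n"
    "similar_mat B (four_block_mat (0\<^sub>m 1 1) C (0\<^sub>m n 1) T)"
    using similar_mat_four_block_0_ex[OF _ T(2) sb(2) zero_carrier_mat sb(4)] unfolding B by blast
  moreover have "upper_triangular (four_block_mat (0\<^sub>m 1 1) C (0\<^sub>m n 1) T)"
    by (rule upper_triangular_four_block[of _ 1 _ n]) (use T in \<open>auto simp: upper_triangular_def\<close>)
  moreover have "four_block_mat (0\<^sub>m 1 1) C (0\<^sub>m n 1) T \<in> carrier_mat (Suc n) (Suc n)"
    using T by (metis four_block_carrier_mat plus_1_eq_Suc zero_carrier_mat)
  ultimately show ?case using similar_mat_trans[OF sim] by blast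
qed

text \<open>A triangular matrix over any field is similar to a Jordan matrix, and the only possible eigenvalue
  of a nilpotent matrix is \<open>0\<close>.\<close>

lemma nilpotent_mat_jordan_nf:
  fixes A :: "'a::field mat"
  assumes A: "A \<in> carrier_mat n n" and nil: "nilpotent_mat A"
  shows "\<exists>ns. similar_mat A (jordan_matrix (map (\<lambda>k. (k, 0)) ns))"
proof -
  obtain B where B: "B \<in> carrier_mat n n" "similar_mat A B" "upper_triangular B"
    using nilpotent_mat_triangularizable[OF assms] by blast
  define n_as where "n_as = triangular_to_jnf_vector B"
  have jnf: "jordan_nf B n_as" unfolding n_as_def by (rule triangular_to_jnf_vector[OF B(1,3)])
  have "snd na = 0" if na: "na \<in> set n_as" for na
  proof -
    obtain k a where ka: "na = (k, a)" by (cases na)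
    have "k \<noteq> 0" using jnf na ka by (force simp: jordan_nf_def)
    hence "poly (char_poly B) a = 0" unfolding jordan_nf_char_poly[OF jnf]
      using na ka by (auto simp: poly_prod_list prod_list_zero_iff image_iff intro!: bexI[of _ "(k, a)"])
    hence "eigenvalue B a" by (simp add: eigenvalue_root_char_poly[OF B(1)])
    thus ?thesis
      using nilpotent_mat_eigenvalue[OF B(1) nilpotent_mat_similar[OF B(2) nil]] ka by simp
  qed
  hence "map (\<lambda>k. (k, 0)) (map fst n_as) = n_as"
    by (auto simp: map_idI prod_eq_iff)
  moreover have "similar_mat A (jordan_matrix n_as)"
    using similar_mat_trans[OF B(2)] jnf by (simp add: jordan_nf_def)
  ultimately show ?thesis by metis
qed

section \<open>The enhanced nilpotent cone\<close>

text \<open>The nilpotent Jordan block \<open>J\<close> commutes with all polynomials in \<open>J\<close>, that is, with all upper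
  triangular Toeplitz matrices. If \<open>v\<^sub>r\<close> is the last nonzero entry of \<open>v\<close>, some invertible one maps
  \<open>e\<^sub>r\<close> to \<open>v\<close>; its inverse maps \<open>v\<close> to a unit vector and still fixes \<open>J\<close> under conjugation.\<close>

lemma jordan_block_0_stabilizer_vec:
  fixes v :: "'a::field vec"
  assumes v: "v \<in> carrier_vec n"
  shows "\<exists>P Q. similar_mat_wit (jordan_block n 0) (jordan_block n 0) P Q \<and>
           (\<forall>i<n. (Q *\<^sub>v v) $ i \<in> {0, 1})"
proof (cases "v = 0\<^sub>v n")
  case True
  have "(1\<^sub>m n *\<^sub>v v) $ i \<in> {0, 1}" if "i < n" for i
    using that True by simp
  thus ?thesis using similar_mat_wit_refl[OF jordan_block_carrier] by blast
next
  case False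
  let ?J = "jordan_block n (0::'a)"
  define S where "S = {i. i < n \<and> v $ i \<noteq> 0}"
  have S: "finite S" "S \<noteq> {}" using False v by (auto simp: S_def)
  define r where "r = Max S"
  have r: "r < n" "v $ r \<noteq> 0" using Max_in[OF S] by (auto simp: r_def S_def)
  have above: "v $ i = 0" if "r < i" "i < n" for i
  proof (rule ccontr)
    assume "v $ i \<noteq> 0"
    hence "i \<le> r" using that(2) S(1) by (auto simp: r_def S_def)
    thus False using that(1) by simp
  qed
  \<comment> \<open>This is \<open>\<Sum>j\<le>r. v\<^bsub>r-j\<^esub> J\<^sup>j\<close>. It maps \<open>e\<^sub>r\<close> to \<open>v\<close> because \<open>J\<^sup>j\<close> maps \<open>e\<^sub>r\<close> to \<open>e\<^bsub>r-j\<^esub>\<close>.\<close>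
  define P where "P = mat n n (\<lambda>(i, j). if i \<le> j \<and> j - i \<le> r then v $ (r - (j - i)) else 0)"
  have P: "P \<in> carrier_mat n n" by (simp add: P_def)
  have "upper_triangular P" by (auto simp: upper_triangular_def P_def)
  hence "det P = prod_list (diag_mat P)" using P by (rule det_upper_triangular)
  also have "\<dots> \<noteq> 0" using r by (auto simp: prod_list_zero_iff diag_mat_def P_def)
  finally have "det P \<noteq> 0" .
  then obtain Q where Q: "Q \<in> carrier_mat n n" "P * Q = 1\<^sub>m n" "Q * P = 1\<^sub>m n"
    using det_nonzero_inverse[OF P] by blast
  have comm: "?J * P = P * ?J"
  proof (rule eq_matI)
    fix i j assume "i < dim_row (P * ?J)" "j < dim_col (P * ?J)"
    hence ij: "i < n" "j < n" using P by auto
    have "(?J * P) $$ (i, j) = (\<Sum>l<n. ?J $$ (i, l) * P $$ (l, j))"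
      using ij P by (simp add: scalar_prod_def atLeast0LessThan)
    also have "\<dots> = (\<Sum>l<n. if l = Suc i then P $$ (l, j) else 0)"
      using ij by (intro sum.cong) auto
    also have "\<dots> = (if Suc i < n then P $$ (Suc i, j) else 0)" by simp
    also have "\<dots> = (if j = 0 then 0 else P $$ (i, j - 1))"
      using ij by (auto simp: P_def)
    also have "\<dots> = (\<Sum>l<n. if l = j - 1 then (if j = 0 then 0 else P $$ (i, l)) else 0)"
      using ij by auto
    also have "\<dots> = (\<Sum>l<n. P $$ (i, l) * ?J $$ (l, j))"
      using ij by (intro sum.cong) auto
    also have "\<dots> = (P * ?J) $$ (i, j)"
      using ij P by (simp add: scalar_prod_def atLeast0LessThan)
    finally show "(?J * P) $$ (i, j) = (P * ?J) $$ (i, j)" .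
  qed (use P in auto)
  have "?J = ?J * (P * Q)" unfolding Q(2) by simp
  also have "\<dots> = ?J * P * Q" using P Q by (simp add: assoc_mult_mat[of _ n n _ n _ n])
  finally have "?J = P * ?J * Q" unfolding comm .
  hence w: "similar_mat_wit ?J ?J P Q"
    using P Q by (intro similar_mat_witI[of _ _ n]) auto
  have "v = col P r"
    using v r above by (intro eq_vecI) (auto simp: P_def)
  also have "\<dots> = P *\<^sub>v unit_vec n r" 
    using P r by (intro eq_vecI) (auto simp: scalar_prod_right_unit)
  finally have "Q *\<^sub>v v = Q *\<^sub>v (P *\<^sub>v unit_vec n r)" by simp
  also have "\<dots> = unit_vec n r" using P Q
    by (metis assoc_mult_mat_vec one_mult_mat_vec unit_vec_carrier)
  finally have "(Q *\<^sub>v v) $ i \<in> {0, 1}" if "i < n" for i using that r by simp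
  thus ?thesis using w by blast
qed

text \<open>The block diagonal matrices built from the matrices that commute with the single blocks commute
  with the whole Jordan matrix, so the components of \<open>v\<close> can be normalised one block at a time.\<close>

lemma jordan_matrix_0_stabilizer_vec:
  fixes v :: "'a::field vec"
  assumes v: "v \<in> carrier_vec (sum_list ns)"
  shows "\<exists>P Q. similar_mat_wit (jordan_matrix (map (\<lambda>k. (k, 0)) ns)) (jordan_matrix (map (\<lambda>k. (k, 0)) ns)) P Q \<and>
           (\<forall>i<sum_list ns. (Q *\<^sub>v v) $ i \<in> {0, 1})"
  using v
proof (induct ns arbitrary: v)
  case Nil
  have "jordan_matrix [] \<in> carrier_mat 0 (0::nat)" by (metis jordan_matrix_carrier list.simps(8) sum_list.Nil)
  from similar_mat_wit_refl[OF this] show ?case by auto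
next
  case (Cons n ns)
  define m where "m = sum_list ns"
  let ?J = "jordan_block n (0::'a)" and ?K = "jordan_matrix (map (\<lambda>k. (k, 0::'a)) ns)"
  have K: "?K \<in> carrier_mat m m"
    using jordan_matrix_carrier[of "map (\<lambda>k. (k, 0::'a)) ns"] by (simp add: m_def comp_def)
  define x y where "x = vec_first v n" and "y = vec_last v m"
  have xy: "x \<in> carrier_vec n" "y \<in> carrier_vec m" "v = x @\<^sub>v y"
    using Cons.prems by (auto simp: x_def y_def m_def)
  obtain P Q where PQ: "similar_mat_wit ?J ?J P Q" "\<forall>i<n. (Q *\<^sub>v x) $ i \<in> {0, 1}"
    using jordan_block_0_stabilizer_vec[OF xy(1)] by blast
  obtain P' Q' where PQ': "similar_mat_wit ?K ?K P' Q'" "\<forall>i<m. (Q' *\<^sub>v y) $ i \<in> {0, 1}"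
    using Cons.hyps xy(2) unfolding m_def by blast
  note c = similar_mat_witD2[OF jordan_block_carrier PQ(1)] similar_mat_witD2[OF K PQ'(1)]
  let ?R = "four_block_mat Q (0\<^sub>m n m) (0\<^sub>m m n) Q'"
  have J: "jordan_matrix (map (\<lambda>k. (k, 0)) (n # ns)) = four_block_mat ?J (0\<^sub>m n m) (0\<^sub>m m n) ?K"
    by (simp add: jordan_matrix_Cons m_def comp_def)
  have "similar_mat_wit (four_block_mat ?J (0\<^sub>m n m) (0\<^sub>m m n) ?K) (four_block_mat ?J (0\<^sub>m n m) (0\<^sub>m m n) ?K)
     (four_block_mat P (0\<^sub>m n m) (0\<^sub>m m n) P') ?R"
    by (rule similar_mat_wit_four_block[OF PQ(1) PQ'(1)]) (use c K in auto)
  moreover have "?R *\<^sub>v v = Q *\<^sub>v x @\<^sub>v Q' *\<^sub>v y"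
    unfolding xy(3) using c xy by (subst four_block_mat_mult_vec[of _ n n _ m _ m]) auto
  hence "(?R *\<^sub>v v) $ i \<in> {0, 1}" if "i < n + m" for i
    using that PQ(2) PQ'(2) c by (cases "i < n") auto
  ultimately show ?case unfolding J using m_def by auto
qed

lemma elements_jordan_matrix_0:
  "elements_mat (jordan_matrix (map (\<lambda>k. (k, 0)) ns)) \<subseteq> {0, 1 :: 'a::field}"
proof -
  have "elements_mat (jordan_block k (0::'a)) \<subseteq> {0, 1}" for k
    by (auto dest!: elements_matD split: if_splits)
  thus ?thesis unfolding jordan_matrix_def
    by (intro order.trans[OF elements_diag_block_mat]) (auto simp: comp_def)
qed

text \<open>The pairs of a nilpotent matrix and a vector form the enhanced nilpotent cone. Bringing the matrix
  to Jordan form and then moving the vector by the centraliser of that form leaves only the entries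
  \<open>0\<close> and \<open>1\<close>, which is all the finiteness results below need. The vector is an
  \<open>n \<times> 1\<close> matrix here since it occurs as a block of a larger matrix.\<close>

lemma nilpotent_mat_col_normal_form:
  fixes A C :: "'a::field mat"
  assumes A: "A \<in> carrier_mat n n" and nil: "nilpotent_mat A" and C: "C \<in> carrier_mat n 1"
  shows "\<exists>B P Q. similar_mat_wit A B P Q \<and> elements_mat B \<subseteq> {0, 1} \<and> elements_mat (Q * C) \<subseteq> {0, 1}"
proof -
  obtain ns P Q where w: "similar_mat_wit A (jordan_matrix (map (\<lambda>k. (k, 0)) ns)) P Q"
    using nilpotent_mat_jordan_nf[OF A nil] by (auto simp: similar_mat_def)
  let ?J = "jordan_matrix (map (\<lambda>k. (k, 0::'a)) ns)"
  note c = similar_mat_witD2[OF A w]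
  have "dim_row ?J = sum_list ns" by (simp add: comp_def)
  hence n: "sum_list ns = n" using c(5) by auto
  define v where "v = Q *\<^sub>v col C 0"
  have v: "v \<in> carrier_vec n"
    unfolding v_def by (intro mult_mat_vec_carrier[OF c(7)] col_carrier_vec[OF _ C]) simp
  obtain P' Q' where w': "similar_mat_wit ?J ?J P' Q'" "\<forall>i<n. (Q' *\<^sub>v v) $ i \<in> {0, 1}"
    using jordan_matrix_0_stabilizer_vec[of v ns] v n by blast
  note c' = similar_mat_witD2[OF c(5) w'(1)]
  have "elements_mat (Q' * Q * C) \<subseteq> {0, 1}"
  proof
    fix e assume "e \<in> elements_mat (Q' * Q * C)"
    then obtain i where i: "i < n" "e = (Q' * Q * C) $$ (i, 0)"
      using c' C by (auto dest!: elements_matD)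
    have "e = col (Q' * Q * C) 0 $ i" using i c c' C by simp
    also have "col (Q' * Q * C) 0 = (Q' * Q) *\<^sub>v col C 0"
      by (rule col_mult2[of _ n n _ 1]) (use c c' C in auto)
    also have "\<dots> = Q' *\<^sub>v v" unfolding v_def
      by (rule assoc_mult_mat_vec) (use c c' C in auto)
    finally show "e \<in> {0, 1}" using w'(2) i by simp
  qed
  thus ?thesis using similar_mat_wit_trans[OF w w'(1)] elements_jordan_matrix_0 by blast
qed

section \<open>Counting the orbits of the Levi subgroup\<close>

lemma block_index_eqI:
  assumes "sum_list (take k b) \<le> i" "i < sum_list (take (Suc k) b)"
  shows "block_index b i = k"
  unfolding block_index_def
proof (rule Least_equality)
  fix l assume l: "i < sum_list (take (Suc l) b)"
  show "k \<le> l"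
  proof (rule ccontr)
    assume "\<not> k \<le> l"
    hence "take k b = take (Suc l) b @ take (k - Suc l) (drop (Suc l) b)"
      by (metis Suc_leI le_add_diff_inverse not_le_imp_less take_add)
    hence "sum_list (take (Suc l) b) \<le> sum_list (take k b)" by simp
    thus False using l assms by simp
  qed
qed (rule assms(2))

lemma nilpotent_cone_parabolic:
  "nilpotent_cone (lie_algebra (sum_list b) (parabolic b)) =
     {X \<in> carrier_mat (sum_list b) (sum_list b). block_upper_triangular b X \<and> nilpotent_mat X}"
  by (auto simp: nilpotent_cone_def lie_algebra_parabolic)

lemma finite_zero_one_mats:
  "finite {B \<in> carrier_mat n m. elements_mat B \<subseteq> {0, 1 :: 'a::zero_neq_one}}"
proof (rule finite_subset)
  let ?f = "\<lambda>S. mat n m (\<lambda>ij. if ij \<in> S then 1 else (0::'a))"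
  show "finite (?f ` Pow ({..<n} \<times> {..<m}))" by simp
  show "{B \<in> carrier_mat n m. elements_mat B \<subseteq> {0, 1}} \<subseteq> ?f ` Pow ({..<n} \<times> {..<m})"
  proof
    fix B :: "'a mat" assume "B \<in> {B \<in> carrier_mat n m. elements_mat B \<subseteq> {0, 1}}"
    hence B: "B \<in> carrier_mat n m" "elements_mat B \<subseteq> {0, 1}" by auto
    have entry: "B $$ (i, j) = 0 \<or> B $$ (i, j) = 1" if "i < n" "j < m" for i j
      using elements_matI[OF B(1) that refl] B(2) by blast
    have "B = ?f {(i, j). i < n \<and> j < m \<and> B $$ (i, j) = 1}"
      using B(1) entry by (intro eq_matI) auto
    thus "B \<in> ?f ` Pow ({..<n} \<times> {..<m})" by blast
  qed
qed

text \<open>There are only finitely many matrices of a given size with entries in \<open>{0, 1}\<close>, so it suffices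
  that every orbit contains one.\<close>

lemma finite_orbits_if_zero_one_representatives:
  fixes b :: "nat list"
  defines "n \<equiv> sum_list b"
  defines "E \<equiv> nilpotent_cone (lie_algebra n (parabolic b :: 'a::alg_closed_field mat set))"
  assumes rep: "\<And>X. X \<in> E \<Longrightarrow> \<exists>B P Q. similar_mat_wit X B P Q \<and> block_diagonal b Q \<and> elements_mat B \<subseteq> {0, 1}"
  shows "finite (orbits (GL n\<lparr>carrier := levi b\<rparr>) E (conjugation n E))"
proof -
  let ?G = "GL n\<lparr>carrier := levi b\<rparr> :: 'a mat monoid" and ?\<phi> = "conjugation n E"
  interpret group_action ?G E ?\<phi> unfolding E_def n_def by (rule levi_action)
  interpret GLn: group "GL n :: 'a mat monoid" by (rule group_GL)
  have "orbits ?G E ?\<phi> \<subseteq> orbit ?G ?\<phi> ` {B \<in> carrier_mat n n. elements_mat B \<subseteq> {0, 1}}"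
  proof
    fix W assume "W \<in> orbits ?G E ?\<phi>"
    then obtain X where X: "X \<in> E" "W = orbit ?G ?\<phi> X" by (auto simp: orbits_def)
    have Xc: "X \<in> carrier_mat n n" using X by (simp add: E_def n_def nilpotent_cone_parabolic)
    obtain B P Q where w: "similar_mat_wit X B P Q" "block_diagonal b Q" "elements_mat B \<subseteq> {0, 1}"
      using rep[OF X(1)] by blast
    note c = similar_mat_witD2[OF Xc w(1)]
    have "det Q * det P = 1" using c by (metis det_mult det_one)
    hence dets: "det P \<noteq> 0" "det Q \<noteq> 0" by auto
    have Q: "Q \<in> levi b" using w c dets by (simp add: levi_alt carrier_GL n_def)
    have "inv\<^bsub>GL n\<^esub> Q = P"
      by (rule GLn.inv_equality) (use c dets in \<open>auto simp: carrier_GL GL_simps\<close>)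
    hence "?\<phi> Q X = Q * X * P" using X by (simp add: conjugation_def)
    also have "\<dots> = B" using similar_mat_wit_sym[OF w(1)] by (simp add: similar_mat_wit_def Let_def)
    finally have B: "?\<phi> Q X = B" .
    hence BO: "B \<in> orbit ?G ?\<phi> X" using Q by (auto simp: orbit_def)
    have BE: "B \<in> E" using B X Q element_image by fastforce
    have "W = orbit ?G ?\<phi> B"
      unfolding X(2)
    proof (intro equalityI subsetI)
      fix Y assume Y: "Y \<in> orbit ?G ?\<phi> X"
      hence "Y \<in> E" using X element_image by (auto simp: orbit_def)
      thus "Y \<in> orbit ?G ?\<phi> B" using orbit_trans[OF BE X(1)] orbit_sym[OF X(1) BE BO] Y by blast
    next
      fix Y assume Y: "Y \<in> orbit ?G ?\<phi> B"
      hence "Y \<in> E" using BE element_image by (auto simp: orbit_def)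
      thus "Y \<in> orbit ?G ?\<phi> X" using orbit_trans[OF X(1) BE] BO Y by blast
    qed
    thus "W \<in> orbit ?G ?\<phi> ` {B \<in> carrier_mat n n. elements_mat B \<subseteq> {0, 1}}"
      using c(5) w(3) by simp
  qed
  thus ?thesis by (rule finite_subset) (intro finite_imageI finite_zero_one_mats)
qed

text \<open>An algebraically closed field is infinite, so a family indexed by it whose members lie in pairwise
  different orbits produces infinitely many orbits. The separation hypothesis avoids inverses.\<close>

lemma infinite_orbits_if_family:
  fixes b :: "nat list" and X :: "'a::alg_closed_field \<Rightarrow> 'a mat"
  defines "n \<equiv> sum_list b"
  defines "E \<equiv> nilpotent_cone (lie_algebra n (parabolic b))"
  assumes X: "\<And>t. X t \<in> E"
    and sep: "\<And>s t g. g \<in> levi b \<Longrightarrow> g * X t = X s * g \<Longrightarrow> s = t"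
  shows "infinite (orbits (GL n\<lparr>carrier := levi b\<rparr>) E (conjugation n E))"
proof -
  let ?G = "GL n\<lparr>carrier := levi b\<rparr> :: 'a mat monoid" and ?\<phi> = "conjugation n E"
  interpret group_action ?G E ?\<phi> unfolding E_def n_def by (rule levi_action)
  have "inj (\<lambda>t. orbit ?G ?\<phi> (X t))"
  proof (rule injI)
    fix s t assume "orbit ?G ?\<phi> (X s) = orbit ?G ?\<phi> (X t)"
    hence "X s \<in> orbit ?G ?\<phi> (X t)" using orbit_refl[OF X] by blast
    then obtain g where g: "g \<in> levi b" "X s = g * X t * inv\<^bsub>GL n\<^esub> g"
      using X by (auto simp: orbit_def conjugation_def)
    have gG: "g \<in> carrier (GL n)" using g by (simp add: levi_alt n_def)
    have c: "g \<in> carrier_mat n n" "X t \<in> carrier_mat n n"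
      using gG X[of t] by (auto simp: carrier_GL E_def n_def nilpotent_cone_parabolic)
    have "X s * g = g * X t * (inv\<^bsub>GL n\<^esub> g * g)" unfolding g(2)
      using c GL_inv(2)[OF gG] by (intro assoc_mult_mat[of _ n n _ n _ n]) auto
    also have "\<dots> = g * X t" using c GL_inv(4)[OF gG] by simp
    finally show "s = t" using sep[OF g(1)] by simp
  qed
  hence "infinite (range (\<lambda>t. orbit ?G ?\<phi> (X t)))"
    using infinite_alg_closed finite_imageD by blast
  moreover have "range (\<lambda>t. orbit ?G ?\<phi> (X t)) \<subseteq> orbits ?G E ?\<phi>"
    using X by (auto simp: orbits_def)
  ultimately show ?thesis by (metis finite_subset)
qed

section \<open>One-parameter families of orbits\<close>

definition unit_mat :: "nat \<Rightarrow> nat \<Rightarrow> nat \<Rightarrow> 'a::zero_neq_one mat" where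
  "unit_mat n i j = mat n n (\<lambda>rc. if rc = (i, j) then 1 else 0)"

lemma unit_mat_carrier [simp]: "unit_mat n i j \<in> carrier_mat n n"
  by (simp add: unit_mat_def)

lemma unit_mat_index [simp]:
  "r < n \<Longrightarrow> c < n \<Longrightarrow> unit_mat n i j $$ (r, c) = (if r = i \<and> c = j then 1 else 0)"
  "dim_row (unit_mat n i j) = n" "dim_col (unit_mat n i j) = n"
  by (auto simp: unit_mat_def)

lemma mult_unit_mat_index:
  fixes g :: "'a::semiring_1 mat"
  assumes "g \<in> carrier_mat n n" "i < n" "r < n" "c < n"
  shows "(g * (a \<cdot>\<^sub>m unit_mat n i j)) $$ (r, c) = (if c = j then g $$ (r, i) * a else 0)"
proof -
  have "(g * (a \<cdot>\<^sub>m unit_mat n i j)) $$ (r, c) = (\<Sum>l<n. g $$ (r, l) * (a * (if l = i \<and> c = j then 1 else 0)))"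
    using assms by (simp add: scalar_prod_def atLeast0LessThan)
  also have "\<dots> = (\<Sum>l<n. if l = i then (if c = j then g $$ (r, l) * a else 0) else 0)"
    by (intro sum.cong) auto
  finally have "(g * (a \<cdot>\<^sub>m unit_mat n i j)) $$ (r, c) = \<dots>" .
  thus ?thesis using assms by simp
qed

lemma unit_mat_mult_index:
  fixes g :: "'a::semiring_1 mat"
  assumes "g \<in> carrier_mat n n" "j < n" "r < n" "c < n"
  shows "((a \<cdot>\<^sub>m unit_mat n i j) * g) $$ (r, c) = (if r = i then a * g $$ (j, c) else 0)"
proof -
  have "((a \<cdot>\<^sub>m unit_mat n i j) * g) $$ (r, c) = (\<Sum>l<n. (a * (if r = i \<and> l = j then 1 else 0)) * g $$ (l, c))"
    using assms by (simp add: scalar_prod_def atLeast0LessThan)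
  also have "\<dots> = (\<Sum>l<n. if l = j then (if r = i then a * g $$ (l, c) else 0) else 0)"
    by (intro sum.cong) auto
  finally have "((a \<cdot>\<^sub>m unit_mat n i j) * g) $$ (r, c) = \<dots>" .
  thus ?thesis using assms by simp
qed

lemma det_zero_col:
  fixes g :: "'a::field mat"
  assumes g: "g \<in> carrier_mat n n" and i: "i < n" and z: "\<And>r. r < n \<Longrightarrow> g $$ (r, i) = 0"
  shows "det g = 0"
proof -
  have "g *\<^sub>v unit_vec n i = 0\<^sub>v n"
    using g i z by (intro eq_vecI) (auto simp: scalar_prod_right_unit)
  thus ?thesis
    using det_0_iff_vec_prod_zero_field[OF g] unit_vec_carrier unit_vec_nonzero[OF i] by blast
qed

lemma unit_mat_other:
  "r < n \<Longrightarrow> c < n \<Longrightarrow> (r, c) \<noteq> (i, j) \<Longrightarrow> unit_mat n i j $$ (r, c) = 0"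
  by simp

text \<open>For three blocks take \<open>X\<^sub>t = E\<^bsub>ij\<^esub> + E\<^bsub>jk\<^esub> + t E\<^bsub>ik\<^esub>\<close> with \<open>i\<close>, \<open>j\<close>, \<open>k\<close> in different
  blocks. Conceptually \<open>t\<close> is an invariant because the block of \<open>X\<^sub>t\<close> that contains \<open>(i, k)\<close> is
  \<open>t\<close> times the product of the blocks that contain \<open>(i, j)\<close> and \<open>(j, k)\<close>, and a block diagonal
  conjugation respects such a relation. Concretely, if \<open>g X\<^sub>t = X\<^sub>s g\<close> with \<open>g\<close> block diagonal,
  comparing entries gives \<open>g\<^bsub>ii\<^esub> = g\<^bsub>jj\<^esub> = g\<^bsub>kk\<^esub>\<close> and \<open>t g\<^bsub>ii\<^esub> = s g\<^bsub>kk\<^esub>\<close>, while column \<open>i\<close> of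
  \<open>g\<close> vanishes off the diagonal.\<close>

lemma infinite_orbits_three_blocks:
  fixes b :: "nat list"
  defines "n \<equiv> sum_list b"
  defines "E \<equiv> nilpotent_cone (lie_algebra n (parabolic b :: 'a::alg_closed_field mat set))"
  assumes ijk: "i < j" "j < k" "k < n"
    and blocks: "block_index b i < block_index b j" "block_index b j < block_index b k"
  shows "infinite (orbits (GL n\<lparr>carrier := levi b\<rparr>) E (conjugation n E))"
proof -
  define X :: "'a \<Rightarrow> 'a mat" where
    "X t = 1 \<cdot>\<^sub>m unit_mat n i j + 1 \<cdot>\<^sub>m unit_mat n j k + t \<cdot>\<^sub>m unit_mat n i k" for t
  have Xc: "X t \<in> carrier_mat n n" for t by (simp add: X_def)
  have X0: "X t $$ (r, c) = 0" if "r < n" "c < n" "(r, c) \<notin> {(i, j), (j, k), (i, k)}" for t r c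
    using that by (simp add: X_def unit_mat_other del: unit_mat_index(1) prod.inject)
  have XE: "X t \<in> E" for t
  proof -
    have "(r, c) \<notin> {(i, j), (j, k), (i, k)}" if "c \<le> r" for r c
      using ijk that by auto
    hence "nilpotent_mat (X t)"
      using X0 by (intro strictly_upper_triangular_nilpotent[OF Xc]) simp
    moreover have "(r, c) \<notin> {(i, j), (j, k), (i, k)}" if "block_index b c < block_index b r" for r c
      using blocks that by auto
    hence "block_upper_triangular b (X t)"
      using X0 by (simp add: block_upper_triangular_def n_def)
    ultimately show ?thesis using Xc by (simp add: E_def n_def nilpotent_cone_parabolic)
  qed
  have sep: "s = t" if g: "g \<in> levi b" and eq: "g * X t = X s * g" for s t and g :: "'a mat"
  proof -
    have gc: "g \<in> carrier_mat n n" "det g \<noteq> 0" using g by (auto simp: levi_alt carrier_GL n_def)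
    have off: "g $$ (r, c) = 0" if "r < n" "c < n" "block_index b r \<noteq> block_index b c" for r c
      using g that by (auto simp: levi_alt block_diagonal_def n_def)
    have l: "(g * X t) $$ (r, c) = (if c = j then g $$ (r, i) else 0) + (if c = k then g $$ (r, j) else 0)
        + (if c = k then g $$ (r, i) * t else 0)" if "r < n" "c < n" for r c
    proof -
      have "g * X t = g * (1 \<cdot>\<^sub>m unit_mat n i j) + g * (1 \<cdot>\<^sub>m unit_mat n j k) + g * (t \<cdot>\<^sub>m unit_mat n i k)"
        unfolding X_def using gc by (simp add: mult_add_distrib_mat[of _ n n _ n])
      thus ?thesis using mult_unit_mat_index[OF gc(1)] that ijk gc by (simp del: index_mult_mat(1))
    qed
    have r: "(X s * g) $$ (r, c) = (if r = i then g $$ (j, c) else 0) + (if r = j then g $$ (k, c) else 0)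
        + (if r = i then s * g $$ (k, c) else 0)" if "r < n" "c < n" for r c
    proof -
      have "X s * g = (1 \<cdot>\<^sub>m unit_mat n i j) * g + (1 \<cdot>\<^sub>m unit_mat n j k) * g + (s \<cdot>\<^sub>m unit_mat n i k) * g"
        unfolding X_def using gc by (simp add: add_mult_distrib_mat[of _ n n _ _ n])
      thus ?thesis using unit_mat_mult_index[OF gc(1)] that ijk gc by (simp del: index_mult_mat(1))
    qed
    have e: "(if c = j then g $$ (r, i) else 0) + (if c = k then g $$ (r, j) else 0)
        + (if c = k then g $$ (r, i) * t else 0)
      = (if r = i then g $$ (j, c) else 0) + (if r = j then g $$ (k, c) else 0)
        + (if r = i then s * g $$ (k, c) else 0)" if "r < n" "c < n" for r c
      unfolding l[OF that, symmetric] r[OF that, symmetric] eq ..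
    have lt: "i < n" "j < n" using ijk by auto
    have z: "g $$ (i, j) = 0" "g $$ (j, i) = 0" "g $$ (j, k) = 0" "g $$ (k, j) = 0"
      using off lt ijk blocks by auto
    have col: "g $$ (r, i) = 0" if "r < n" "r \<noteq> i" for r
    proof (cases "r = j")
      case False
      thus ?thesis using e[of r j] that lt ijk by simp
    qed (use z in simp)
    \<comment> \<open>otherwise column \<open>i\<close> of the invertible matrix \<open>g\<close> would vanish\<close>
    have "g $$ (i, i) \<noteq> 0" using det_zero_col[OF gc(1) lt(1)] col gc(2) by metis
    moreover have "g $$ (i, i) = g $$ (j, j)"
      using e[of i j] lt ijk z by simp
    moreover have "g $$ (j, j) = g $$ (k, k)"
      using e[of j k] lt ijk z by simp
    moreover have "g $$ (i, i) * t = s * g $$ (k, k)"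
      using e[of i k] lt ijk z by simp
    ultimately show "s = t" by simp
  qed
  show ?thesis
    using infinite_orbits_if_family[of X b] XE sep unfolding E_def n_def by blast
qed

text \<open>With \<open>i\<close>, \<open>i'\<close> in one block and \<open>m\<close>, \<open>m'\<close> in a later one, \<open>X\<^sub>t\<close> has a \<open>2 \<times> 2\<close> Jordan block on
  either pair of indices, and \<open>B\<close> with rows \<open>(0, t)\<close>, \<open>(1, 0)\<close> as its off-diagonal block.
  Matrices \<open>a + bJ\<close> and \<open>c + dJ\<close> commuting with the Jordan blocks send \<open>B\<close> to
  \<open>(a + bJ) B (c + dJ)\<^sup>-\<^sup>1\<close>, which scales \<open>det B\<close> by \<open>(a/c)\<^sup>2\<close> and the lower left entry of
  \<open>B\<close> by \<open>a/c\<close>; the quotient of \<open>det B\<close> by the square of that entry, here \<open>-t\<close>, is therefore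
  unchanged. For larger blocks the comparison of the entries of \<open>g X\<^sub>t\<close> and \<open>X\<^sub>s g\<close> shows
  the same: the diagonal entries of \<open>g\<close> at the four indices agree, column \<open>i\<close> of \<open>g\<close> vanishes off
  the diagonal, and \<open>t g\<^bsub>ii\<^esub> = s g\<^bsub>m'm'\<^esub>\<close>.\<close>

lemma infinite_orbits_two_large_blocks:
  fixes b :: "nat list"
  defines "n \<equiv> sum_list b"
  defines "E \<equiv> nilpotent_cone (lie_algebra n (parabolic b :: 'a::alg_closed_field mat set))"
  assumes ord: "i < i'" "i' < m" "m < m'" "m' < n"
    and blocks: "block_index b i = block_index b i'" "block_index b i' < block_index b m"
      "block_index b m = block_index b m'"
  shows "infinite (orbits (GL n\<lparr>carrier := levi b\<rparr>) E (conjugation n E))"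
proof -
  define X :: "'a \<Rightarrow> 'a mat" where
    "X t = 1 \<cdot>\<^sub>m unit_mat n i i' + 1 \<cdot>\<^sub>m unit_mat n m m' + 1 \<cdot>\<^sub>m unit_mat n i' m
       + t \<cdot>\<^sub>m unit_mat n i m'" for t
  have Xc: "X t \<in> carrier_mat n n" for t by (simp add: X_def)
  have X0: "X t $$ (r, c) = 0" if "r < n" "c < n" "(r, c) \<notin> {(i, i'), (m, m'), (i', m), (i, m')}" for t r c
    using that by (simp add: X_def unit_mat_other del: unit_mat_index(1) prod.inject)
  have XE: "X t \<in> E" for t
  proof -
    have "(r, c) \<notin> {(i, i'), (m, m'), (i', m), (i, m')}" if "c \<le> r" for r c
      using ord that by auto
    hence "nilpotent_mat (X t)"
      using X0 by (intro strictly_upper_triangular_nilpotent[OF Xc]) simp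
    moreover have "(r, c) \<notin> {(i, i'), (m, m'), (i', m), (i, m')}" if "block_index b c < block_index b r" for r c
      using blocks that by auto
    hence "block_upper_triangular b (X t)"
      using X0 by (simp add: block_upper_triangular_def n_def)
    ultimately show ?thesis using Xc by (simp add: E_def n_def nilpotent_cone_parabolic)
  qed
  have sep: "s = t" if g: "g \<in> levi b" and eq: "g * X t = X s * g" for s t and g :: "'a mat"
  proof -
    have gc: "g \<in> carrier_mat n n" "det g \<noteq> 0" using g by (auto simp: levi_alt carrier_GL n_def)
    have off: "g $$ (r, c) = 0" if "r < n" "c < n" "block_index b r \<noteq> block_index b c" for r c
      using g that by (auto simp: levi_alt block_diagonal_def n_def)
    have l: "(g * X t) $$ (r, c) = (if c = i' then g $$ (r, i) else 0) + (if c = m' then g $$ (r, m) else 0)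
        + (if c = m then g $$ (r, i') else 0) + (if c = m' then g $$ (r, i) * t else 0)"
      if "r < n" "c < n" for r c
    proof -
      have "g * X t = g * (1 \<cdot>\<^sub>m unit_mat n i i') + g * (1 \<cdot>\<^sub>m unit_mat n m m')
          + g * (1 \<cdot>\<^sub>m unit_mat n i' m) + g * (t \<cdot>\<^sub>m unit_mat n i m')"
        unfolding X_def using gc by (simp add: mult_add_distrib_mat[of _ n n _ n])
      thus ?thesis using mult_unit_mat_index[OF gc(1)] that ord gc by (simp del: index_mult_mat(1))
    qed
    have r: "(X s * g) $$ (r, c) = (if r = i then g $$ (i', c) else 0) + (if r = m then g $$ (m', c) else 0)
        + (if r = i' then g $$ (m, c) else 0) + (if r = i then s * g $$ (m', c) else 0)"
      if "r < n" "c < n" for r c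
    proof -
      have "X s * g = (1 \<cdot>\<^sub>m unit_mat n i i') * g + (1 \<cdot>\<^sub>m unit_mat n m m') * g
          + (1 \<cdot>\<^sub>m unit_mat n i' m) * g + (s \<cdot>\<^sub>m unit_mat n i m') * g"
        unfolding X_def using gc by (simp add: add_mult_distrib_mat[of _ n n _ _ n])
      thus ?thesis using unit_mat_mult_index[OF gc(1)] that ord gc by (simp del: index_mult_mat(1))
    qed
    have e: "(if c = i' then g $$ (r, i) else 0) + (if c = m' then g $$ (r, m) else 0)
        + (if c = m then g $$ (r, i') else 0) + (if c = m' then g $$ (r, i) * t else 0)
      = (if r = i then g $$ (i', c) else 0) + (if r = m then g $$ (m', c) else 0)
        + (if r = i' then g $$ (m, c) else 0) + (if r = i then s * g $$ (m', c) else 0)"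
      if "r < n" "c < n" for r c
      unfolding l[OF that, symmetric] r[OF that, symmetric] eq ..
    have lt: "i < n" "i' < n" "m < n" using ord by auto
    have z: "g $$ (i, m) = 0" "g $$ (i', m') = 0" "g $$ (m, i) = 0" "g $$ (m, i') = 0" "g $$ (m', i') = 0"
      "g $$ (i', m) = 0"
      using off lt ord(4) blocks less_imp_neq[OF blocks(2)] less_imp_neq[OF blocks(2), symmetric]
      by simp_all
    have col: "g $$ (r, i) = 0" if "r < n" "r \<noteq> i" for r
      using e[of r i'] that lt ord z by (simp split: if_splits)
    \<comment> \<open>otherwise column \<open>i\<close> of the invertible matrix \<open>g\<close> would vanish\<close>
    have "g $$ (i, i) \<noteq> 0" using det_zero_col[OF gc(1) lt(1)] col gc(2) by metis
    moreover have "g $$ (i, i) = g $$ (i', i')"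
      using e[of i i'] lt ord z by simp
    moreover have "g $$ (i', i') = g $$ (m, m)"
      using e[of i' m] lt ord z by simp
    moreover have "g $$ (m, m) = g $$ (m', m')"
      using e[of m m'] lt ord z by simp
    moreover have "g $$ (i, i) * t = s * g $$ (m', m')"
      using e[of i m'] lt ord z by simp
    ultimately show "s = t" by simp
  qed
  show ?thesis
    using infinite_orbits_if_family[of X b] XE sep unfolding E_def n_def by blast
qed

section \<open>Parabolic subgroups with finitely many orbits\<close>

lemma block_index_two:
  assumes "i < a + c"
  shows "block_index [a, c] i = (if i < a then 0 else 1)"
  using assms by (auto intro!: block_index_eqI)

lemma block_diagonal_four_block:
  assumes "A \<in> carrier_mat a a" "D \<in> carrier_mat c c"
  shows "block_diagonal [a, c] (four_block_mat A (0\<^sub>m a c) (0\<^sub>m c a) D)"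
  using assms by (auto simp: block_diagonal_def block_index_two split: if_splits)

lemma block_upper_triangular_two:
  assumes X: "X \<in> carrier_mat (a + c) (a + c)" and up: "block_upper_triangular [a, c] X"
  obtains A B D where "A \<in> carrier_mat a a" "B \<in> carrier_mat a c" "D \<in> carrier_mat c c"
    "X = four_block_mat A B (0\<^sub>m c a) D"
proof -
  obtain A B C D where s: "split_block X a a = (A, B, C, D)" by (cases "split_block X a a") auto
  have d: "dim_row X = a + c" "dim_col X = a + c" using X by auto
  note sb = split_block[OF s d]
  have "X $$ (a + i, j) = 0" if "i < c" "j < a" for i j
    using up that by (auto simp: block_upper_triangular_def block_index_two)
  hence "C = 0\<^sub>m c a" using s d
    by (auto simp: split_block_def Let_def add.commute intro!: eq_matI)
  thus ?thesis using that sb by blast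
qed

lemma block_diagonal_single:
  assumes "length b \<le> 1"
  shows "block_diagonal b A"
proof -
  have "block_index b i = 0" if "i < sum_list b" for i
    using that assms by (intro block_index_eqI) (cases b; auto)+
  thus ?thesis by (auto simp: block_diagonal_def)
qed

lemma finite_orbits_single_block:
  fixes b :: "nat list"
  defines "E \<equiv> nilpotent_cone (lie_algebra (sum_list b) (parabolic b :: 'a::alg_closed_field mat set))"
  assumes b: "length b \<le> 1"
  shows "finite (orbits (GL (sum_list b)\<lparr>carrier := levi b\<rparr>) E (conjugation (sum_list b) E))"
  unfolding E_def
proof (rule finite_orbits_if_zero_one_representatives)
  let ?n = "sum_list b"
  fix X :: "'a mat" assume "X \<in> nilpotent_cone (lie_algebra ?n (parabolic b))"
  hence X: "X \<in> carrier_mat ?n ?n" "nilpotent_mat X" by (auto simp: nilpotent_cone_parabolic)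
  show "\<exists>B P Q. similar_mat_wit X B P Q \<and> block_diagonal b Q \<and> elements_mat B \<subseteq> {0, 1}"
    using nilpotent_mat_col_normal_form[OF X zero_carrier_mat] block_diagonal_single[OF b] by blast
qed

text \<open>An element of the cone is a nilpotent matrix \<open>A\<close> with a column \<open>C\<close> beside it; the lower right
  corner is a nilpotent scalar. The first factor of the Levi subgroup acts on \<open>(A, C)\<close> exactly as
  on the enhanced nilpotent cone, so the subgroup \<open>GL\<^sub>m \<times> 1\<close> already has finitely many orbits.\<close>

lemma finite_orbits_last_block_1:
  fixes m :: nat
  defines "b \<equiv> [m, 1]"
  defines "E \<equiv> nilpotent_cone (lie_algebra (sum_list b) (parabolic b :: 'a::alg_closed_field mat set))"
  shows "finite (orbits (GL (sum_list b)\<lparr>carrier := levi b\<rparr>) E (conjugation (sum_list b) E))"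
  unfolding E_def
proof (rule finite_orbits_if_zero_one_representatives)
  fix X :: "'a mat" assume "X \<in> nilpotent_cone (lie_algebra (sum_list b) (parabolic b))"
  hence X: "X \<in> carrier_mat (m + 1) (m + 1)" "block_upper_triangular [m, 1] X" "nilpotent_mat X"
    unfolding nilpotent_cone_parabolic by (auto simp: b_def)
  obtain A C D where bl: "A \<in> carrier_mat m m" "C \<in> carrier_mat m 1" "D \<in> carrier_mat 1 1"
    and eq: "X = four_block_mat A C (0\<^sub>m 1 m) D"
    using block_upper_triangular_two[OF X(1,2)] .
  note nil = nilpotent_four_block_upperD[OF bl X(3)[unfolded eq]]
  have D: "D = 0\<^sub>m 1 1" using nilpotent_mat_1x1[OF bl(3) nil(2)] .
  obtain B P Q where w: "similar_mat_wit A B P Q" "elements_mat B \<subseteq> {0, 1}" "elements_mat (Q * C) \<subseteq> {0, 1}"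
    using nilpotent_mat_col_normal_form[OF bl(1) nil(1) bl(2)] by blast
  note c = similar_mat_witD2[OF bl(1) w(1)]
  let ?R = "four_block_mat Q (0\<^sub>m m 1) (0\<^sub>m 1 m) (1\<^sub>m 1)"
  have "P * (Q * C) = C" using c bl by (simp add: assoc_mult_mat[of _ m m _ m _ 1, symmetric])
  hence C: "C = P * (Q * C) * 1\<^sub>m 1" using bl by simp
  have "similar_mat_wit X (four_block_mat B (Q * C) (0\<^sub>m 1 m) (0\<^sub>m 1 1))
      (four_block_mat P (0\<^sub>m m 1) (0\<^sub>m 1 m) (1\<^sub>m 1)) ?R"
    unfolding eq D
    by (rule similar_mat_wit_four_block[OF w(1) similar_mat_wit_refl[OF zero_carrier_mat] C])
      (use c bl in auto)
  moreover have "block_diagonal b ?R"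
    unfolding b_def by (rule block_diagonal_four_block) (use c in auto)
  moreover have "elements_mat (four_block_mat B (Q * C) (0\<^sub>m 1 m) (0\<^sub>m 1 1)) \<subseteq> {0, 1}"
    by (intro order.trans[OF elements_four_block_mat[of _ m m _ 1 _ 1]])
      (use c bl w elements_0_mat in auto)
  ultimately show "\<exists>B P Q. similar_mat_wit X B P Q \<and> block_diagonal b Q \<and> elements_mat B \<subseteq> {0, 1}"
    by blast
qed

lemma elements_transpose_mat: "elements_mat (transpose_mat A) = elements_mat A"
  by (auto dest!: elements_matD intro!: elements_matI[OF carrier_matI[OF refl refl]])

lemma nilpotent_mat_transpose:
  fixes A :: "'a::comm_semiring_1 mat"
  assumes A: "A \<in> carrier_mat n n" and nil: "nilpotent_mat A"
  shows "nilpotent_mat (transpose_mat A)"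
proof -
  obtain k where k: "A ^\<^sub>m k = 0\<^sub>m n n" using A nil by (auto simp: nilpotent_mat_def)
  have left: "A ^\<^sub>m Suc k = A * A ^\<^sub>m k" for k
  proof (induct k)
    case (Suc k)
    have "A ^\<^sub>m Suc (Suc k) = A * A ^\<^sub>m k * A" by (simp only: pow_mat.simps(2) Suc[simplified])
    also have "\<dots> = A * A ^\<^sub>m Suc k" using A by (simp add: assoc_mult_mat[of _ n n _ n _ n])
    finally show ?case .
  qed (use A in auto)
  have pow: "transpose_mat A ^\<^sub>m k = transpose_mat (A ^\<^sub>m k)" for k
  proof (induct k)
    case (Suc k)
    have "transpose_mat (A * A ^\<^sub>m k) = transpose_mat (A ^\<^sub>m k) * transpose_mat A"
      using A by (intro transpose_mult[of _ n n _ n]) auto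
    thus ?case unfolding left using Suc by simp
  qed (use A in auto)
  show ?thesis unfolding nilpotent_mat_def using A k by (intro exI[of _ k]) (simp add: pow)
qed

lemma similar_mat_wit_transpose:
  fixes A :: "'a::comm_semiring_1 mat"
  assumes "similar_mat_wit A B P Q"
  shows "similar_mat_wit (transpose_mat A) (transpose_mat B) (transpose_mat Q) (transpose_mat P)"
proof -
  define n where "n = dim_row A"
  note c = similar_mat_witD[OF n_def assms]
  show ?thesis
  proof (rule similar_mat_witI[of _ _ n])
    show "transpose_mat Q * transpose_mat P = 1\<^sub>m n" "transpose_mat P * transpose_mat Q = 1\<^sub>m n"
      using c by (simp_all flip: transpose_mult[of _ n n _ n])
    have "transpose_mat A = transpose_mat (P * B * Q)" using c by simp
    also have "\<dots> = transpose_mat Q * (transpose_mat B * transpose_mat P)"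
      using c by (simp add: transpose_mult[of _ n n _ n])
    also have "\<dots> = transpose_mat Q * transpose_mat B * transpose_mat P"
      using c by (simp add: assoc_mult_mat[of _ n n _ n _ n])
    finally show "transpose_mat A = transpose_mat Q * transpose_mat B * transpose_mat P" .
  qed (use c in auto)
qed

text \<open>The mirror image of the previous case: the off-diagonal block is a row \<open>C\<close>, and transposing turns
  it into a column acted on together with the transpose of \<open>A\<close>. The conjugating matrices come back
  transposed and interchanged.\<close>

lemma finite_orbits_first_block_1:
  fixes m :: nat
  defines "b \<equiv> [1, m]"
  defines "E \<equiv> nilpotent_cone (lie_algebra (sum_list b) (parabolic b :: 'a::alg_closed_field mat set))"
  shows "finite (orbits (GL (sum_list b)\<lparr>carrier := levi b\<rparr>) E (conjugation (sum_list b) E))"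
  unfolding E_def
proof (rule finite_orbits_if_zero_one_representatives)
  fix X :: "'a mat" assume "X \<in> nilpotent_cone (lie_algebra (sum_list b) (parabolic b))"
  hence X: "X \<in> carrier_mat (1 + m) (1 + m)" "block_upper_triangular [1, m] X" "nilpotent_mat X"
    unfolding nilpotent_cone_parabolic by (auto simp: b_def)
  obtain D C A where bl: "D \<in> carrier_mat 1 1" "C \<in> carrier_mat 1 m" "A \<in> carrier_mat m m"
    and eq: "X = four_block_mat D C (0\<^sub>m m 1) A"
    using block_upper_triangular_two[OF X(1,2)] .
  note nil = nilpotent_four_block_upperD[OF bl X(3)[unfolded eq]]
  have D: "D = 0\<^sub>m 1 1" using nilpotent_mat_1x1[OF bl(1) nil(1)] .
  have At: "transpose_mat A \<in> carrier_mat m m" "transpose_mat C \<in> carrier_mat m 1" using bl by auto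
  obtain B P Q where w: "similar_mat_wit (transpose_mat A) B P Q" "elements_mat B \<subseteq> {0, 1}"
      "elements_mat (Q * transpose_mat C) \<subseteq> {0, 1}"
    using nilpotent_mat_col_normal_form[OF At(1) nilpotent_mat_transpose[OF bl(3) nil(2)] At(2)] by blast
  note c = similar_mat_witD2[OF At(1) w(1)]
  have w': "similar_mat_wit A (transpose_mat B) (transpose_mat Q) (transpose_mat P)"
    using similar_mat_wit_transpose[OF w(1)] by simp
  note c' = similar_mat_witD2[OF bl(3) w']
  let ?R = "four_block_mat (1\<^sub>m 1) (0\<^sub>m 1 m) (0\<^sub>m m 1) (transpose_mat P)"
  let ?C = "C * transpose_mat Q"
  have CQ: "?C = transpose_mat (Q * transpose_mat C)"
    using c bl by (simp add: transpose_mult[of _ m m _ 1])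
  have "?C * transpose_mat P = C" using c' bl by (simp add: assoc_mult_mat[of _ 1 m _ m _ m])
  hence C: "C = 1\<^sub>m 1 * ?C * transpose_mat P" using bl c' by simp
  have "similar_mat_wit X (four_block_mat (0\<^sub>m 1 1) ?C (0\<^sub>m m 1) (transpose_mat B))
      (four_block_mat (1\<^sub>m 1) (0\<^sub>m 1 m) (0\<^sub>m m 1) (transpose_mat Q)) ?R"
    unfolding eq D
    by (rule similar_mat_wit_four_block[OF similar_mat_wit_refl[OF zero_carrier_mat] w' C])
      (use c' bl in auto)
  moreover have "block_diagonal b ?R"
    unfolding b_def by (rule block_diagonal_four_block) (use c' in auto)
  moreover have "elements_mat (four_block_mat (0\<^sub>m 1 1) ?C (0\<^sub>m m 1) (transpose_mat B)) \<subseteq> {0, 1}"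
    by (intro order.trans[OF elements_four_block_mat[of _ 1 1 _ m _ m]])
      (use c' bl w elements_0_mat in \<open>auto simp: elements_transpose_mat CQ\<close>)
  ultimately show "\<exists>B P Q. similar_mat_wit X B P Q \<and> block_diagonal b Q \<and> elements_mat B \<subseteq> {0, 1}"
    by blast
qed

lemma parabolic_single_block:
  assumes "length b \<le> 1"
  shows "parabolic b = carrier (GL (sum_list b))"
  using block_diagonal_imp_upper[OF block_diagonal_single[OF assms]]
  by (auto simp: parabolic_def)

text \<open>An elementary matrix with its off-diagonal \<open>1\<close> in the first column and in the first row of the
  second block is invertible but not block upper triangular.\<close>

lemma parabolic_neq_GL:
  assumes pos: "\<forall>x\<in>set b. 1 \<le> x" and len: "length b \<ge> 2"
  shows "parabolic b \<noteq> (carrier (GL (sum_list b)) :: 'a::field mat set)"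
proof -
  let ?n = "sum_list b"
  obtain a c r where b: "b = a # c # r"
    using len by (metis One_nat_def Suc_1 Suc_le_length_iff)
  have ac: "a \<ge> 1" "c \<ge> 1" using pos b by auto
  have n: "a + c \<le> ?n" using b by simp
  let ?g = "addrow_mat ?n (1::'a) a 0"
  have "block_index b 0 = 0" "block_index b a = 1"
    using ac by (auto intro!: block_index_eqI simp: b)
  hence "?g $$ (a, 0) = 0" if "block_upper_triangular b ?g"
    using that[unfolded block_upper_triangular_def, rule_format, of a 0] ac n by simp
  moreover have "?g $$ (a, 0) \<noteq> 0" using ac n by simp
  ultimately have "\<not> block_upper_triangular b ?g" by blast
  moreover have "?g \<in> carrier (GL ?n)"
    using ac by (simp add: carrier_GL det_addrow_mat)
  ultimately show ?thesis by (auto simp: parabolic_def)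
qed

section \<open>The classification\<close>

theorem lemma3p7:
  fixes P L \<pp> N :: "'a::alg_closed_field mat set"
    and b :: "nat list" and n :: nat
  assumes "\<forall>x\<in>set b. 1 \<le> x"
    and "sum_list b = n"
    and "P = parabolic b"
    and "L = levi b"
    and "\<pp> = lie_algebra n P"
    and "N = nilpotent_cone \<pp>"
  shows "finite (orbits ((GL n)\<lparr>carrier := L\<rparr>) N (conjugation n N)) \<longleftrightarrow>
    P = carrier (GL n) \<or> b = [1, n - 1] \<or> b = [n - 1, 1]"
proof -
  note pos = assms(1)
  note n = assms(2)[symmetric]
  have N: "N = nilpotent_cone (lie_algebra n (parabolic b))" using assms by simp
  consider (one) "length b \<le> 1" | (first) m where "b = [1, m]" | (last) m where "b = [m, 1]"
    | (two) a c where "b = [a, c]" "a \<ge> 2" "c \<ge> 2"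
    | (many) a c d r where "b = a # c # d # r"
  proof -
    show thesis
    proof (cases b)
      case Nil
      thus thesis using one by simp
    next
      case b1: (Cons a b')
      show thesis
      proof (cases b')
        case Nil
        thus thesis using one b1 by simp
      next
        case b2: (Cons c b'')
        have "a \<ge> 1" "c \<ge> 1" using pos b1 b2 by auto
        thus thesis
          using first[of c] last[of a] two[of a c] many[of a c] b1 b2 by (cases b''; cases "a = 1"; cases "c = 1") auto
      qed
    qed
  qed
  thus ?thesis
  proof cases
    case one
    have "finite (orbits (GL n\<lparr>carrier := L\<rparr>) N (conjugation n N))"
      unfolding N n assms(4) by (rule finite_orbits_single_block[OF one])
    thus ?thesis by (simp add: parabolic_single_block[OF one] assms(3) n)
  next
    case (first m)
    have "finite (orbits (GL n\<lparr>carrier := L\<rparr>) N (conjugation n N))"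
      unfolding N n assms(4) first by (rule finite_orbits_first_block_1)
    thus ?thesis using first n by simp
  next
    case (last m)
    have "finite (orbits (GL n\<lparr>carrier := L\<rparr>) N (conjugation n N))"
      unfolding N n assms(4) last by (rule finite_orbits_last_block_1)
    thus ?thesis using last n by simp
  next
    case (two a c)
    have bi: "block_index b i = (if i < a then 0 else 1)" if "i < a + c" for i
      unfolding two(1) using that by (rule block_index_two)
    have "infinite (orbits (GL n\<lparr>carrier := L\<rparr>) N (conjugation n N))"
      unfolding N n assms(4)
      by (rule infinite_orbits_two_large_blocks[of 0 1 a "a + 1"]) (use two bi in auto)
    moreover have "P \<noteq> carrier (GL n)" using parabolic_neq_GL[OF pos] two assms(3) n by simp
    ultimately show ?thesis using two by auto
  next
    case (many a c d r)
    have "a \<ge> 1" "c \<ge> 1" "d \<ge> 1" using pos many by auto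
    hence bi: "block_index b 0 = 0" "block_index b a = 1" "block_index b (a + c) = 2"
      by (auto intro!: block_index_eqI simp: many numeral_2_eq_2)
    have "infinite (orbits (GL n\<lparr>carrier := L\<rparr>) N (conjugation n N))"
      unfolding N n assms(4)
      by (rule infinite_orbits_three_blocks[of 0 a "a + c"])
        (use many bi \<open>a \<ge> 1\<close> \<open>c \<ge> 1\<close> \<open>d \<ge> 1\<close> in auto)
    moreover have "P \<noteq> carrier (GL n)" using parabolic_neq_GL[OF pos] many assms(3) n by simp
    ultimately show ?thesis using many by auto
  qed
qed

end
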